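(* Let $(u,v,g,h)$ be the unique global solution of the free boundary problem described in the context. (i) If $g_\infty<\infty$ and $h_\infty=\infty$, then $\lim_{t\to\infty}v(t,x)=1$ uniformly in any compact subset of $[0,\infty)$. (ii) If $h_\infty<\infty$ and $g_\infty=\infty$, then $\lim_{t\to\infty}u(t,x)=a$ uniformly in any compact subset of $[0,\infty)$.
   Context: Let $a,b,c,d,\beta,\mu>0$ and $0<h_0\le g_0$. Let $u_0\in C^2([0,g_0])$ with $u_0'(0)=0$, $u_0>0$ in $[0,g_0)$, $u_0=0$ in $[g_0,\infty)$, and $v_0\in C^2([0,h_0])$ with $v_0'(0)=0$, $v_0>0$ in $[0,h_0)$, $v_0=0$ in $[h_0,\infty)$. The problem is: $u_t-du_{xx}=u(a-u-bv)$ for $t>0$, $0<x<g(t)$; $v_t-v_{xx}=v(1-v+cu)$ for $t>0$, $0<x<h(t)$; $u_x(t,0)=v_x(t,0)=0$; $g'(t)=-\beta u_x(t,g(t))$, $h'(t)=-\mu v_x(t,h(t))$; $u(t,x)=0$ for $x\ge g(t)$, $v(t,x)=0$ for $x\ge h(t)$; $u(0,\cdot)=u_0$, $v(0,\cdot)=v_0$, $g(0)=g_0$, $h(0)=h_0$. It has a unique global classical solution with $g,h$ increasing; $g_\infty=\lim_{t\to\infty}g(t)\in(0,\infty]$, $h_\infty=\lim_{t\to\infty}h(t)\in(0,\infty]$. *)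

theory Defs
  imports "HOL-Analysis.Analysis"
begin

definition C2_on_interval :: "(real \<Rightarrow> real) \<Rightarrow> real \<Rightarrow> bool" where
  "C2_on_interval f L \<longleftrightarrow>
     (\<exists>f1 f2. (\<forall>x\<in>{0..L}. (f has_real_derivative f1 x) (at x within {0..L})
                          \<and> (f1 has_real_derivative f2 x) (at x within {0..L}))
               \<and> continuous_on {0..L} f2)"

definition admissible_init :: "(real \<Rightarrow> real) \<Rightarrow> real \<Rightarrow> bool" where
  "admissible_init w0 s0 \<longleftrightarrow>
     C2_on_interval w0 s0
     \<and> ((w0 has_real_derivative 0) (at 0 within {0..s0}))
     \<and> (\<forall>x\<in>{0..<s0}. w0 x > 0)
     \<and> (\<forall>x\<ge>s0. w0 x = 0)"

definition fb_component ::
  "real \<Rightarrow> (real \<Rightarrow> real \<Rightarrow> real) \<Rightarrow> real \<Rightarrow> (real \<Rightarrow> real) \<Rightarrow> real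
    \<Rightarrow> (real \<Rightarrow> real \<Rightarrow> real) \<Rightarrow> (real \<Rightarrow> real) \<Rightarrow> bool" where
  "fb_component D F k w0 s0 w s \<longleftrightarrow>
     s 0 = s0 \<and> continuous_on {0..} s \<and> (\<forall>t\<ge>0. s t > 0)
     \<and> continuous_on ({0..} \<times> {0..}) (\<lambda>(t,x). w t x)
     \<and> (\<forall>x\<ge>0. w 0 x = w0 x)
     \<and> (\<forall>t\<ge>0. \<forall>x\<ge>s t. w t x = 0)
     \<and> (\<exists>wx wxx wt.
          continuous_on {(t,x). t > 0 \<and> 0 \<le> x \<and> x \<le> s t} (\<lambda>(t,x). wx t x)
          \<and> (\<forall>t>0. \<forall>x\<in>{0..s t}.
                ((\<lambda>y. w t y) has_real_derivative wx t x) (at x within {0..s t}))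
          \<and> (\<forall>t>0. \<forall>x\<in>{0<..<s t}.
                ((\<lambda>y. wx t y) has_real_derivative wxx t x) (at x)
              \<and> ((\<lambda>\<tau>. w \<tau> x) has_real_derivative wt t x) (at t)
              \<and> wt t x - D * wxx t x = F t x)
          \<and> (\<forall>t>0. wx t 0 = 0)
          \<and> (\<forall>t>0. (s has_real_derivative (- k * wx t (s t))) (at t)))"

definition fb_solution ::
  "real \<Rightarrow> real \<Rightarrow> real \<Rightarrow> real \<Rightarrow> real \<Rightarrow> real \<Rightarrow> real \<Rightarrow> real
    \<Rightarrow> (real \<Rightarrow> real) \<Rightarrow> (real \<Rightarrow> real)
    \<Rightarrow> (real \<Rightarrow> real \<Rightarrow> real) \<Rightarrow> (real \<Rightarrow> real \<Rightarrow> real) \<Rightarrow> (real \<Rightarrow> real) \<Rightarrow> (real \<Rightarrow> real) \<Rightarrow> bool" where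
  "fb_solution a b c d \<beta> \<mu> g0 h0 u0 v0 u v g h \<longleftrightarrow>
     fb_component d (\<lambda>t x. u t x * (a - u t x - b * v t x)) \<beta> u0 g0 u g
   \<and> fb_component 1 (\<lambda>t x. v t x * (1 - v t x + c * u t x)) \<mu> v0 h0 v h"

end

theory Submission
  imports Defs
begin

text \<open>
  The second derivatives of a solution are not assumed to be continuous, so everything rests on the
  maximum principle. It gives nonnegativity, boundedness and, by doubling the space variable,
  a Lipschitz bound in \<open>x\<close> that is uniform in time.

  If a free boundary \<open>s\<close> converges, its species dies out uniformly: were \<open>w t x > \<epsilon>\<close> for some large
  \<open>t\<close>, the Lipschitz bound would put a bump of fixed height and width under \<open>w t\<close>. For each \<open>t1\<close> in
  \<open>[t + 1, t + 2]\<close> an exponentially damped Gaussian bump, a subsolution as long as its speed stays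
  bounded, can be moved from there so that its right edge meets the free boundary at time \<open>t1\<close>.
  Its slope at the edge bounds \<open>s'\<close> at \<open>t1\<close> below by a constant independent of \<open>t\<close>, which
  contradicts convergence.

  Once one species has died out, the other satisfies a perturbed logistic equation on an interval
  growing to \<open>[0, \<infinity>)\<close>. It is bounded above by a space-independent supersolution, and below by
  \<open>p t * cos (\<pi> * x / (2 * l))\<close> with \<open>l\<close> large and \<open>p\<close> growing to \<open>A - D * (\<pi> / (2 * l))\<^sup>2\<close>.
\<close>

section \<open>A comparison principle\<close>

lemma second_derivative_nonpos_at_max:
  fixes f f' :: "real \<Rightarrow> real"
  assumes x: "x \<in> {a<..<b}"
    and f': "\<And>y. y \<in> {a<..<b} \<Longrightarrow> (f has_real_derivative f' y) (at y)"
    and f'': "(f' has_real_derivative m) (at x)"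
    and max: "\<And>y. y \<in> {a<..<b} \<Longrightarrow> f y \<le> f x"
  shows "m \<le> 0"
proof (rule ccontr)
  assume "\<not> m \<le> 0"
  then obtain e where e: "e > 0" "\<And>h. 0 < h \<Longrightarrow> h < e \<Longrightarrow> f' x < f' (x + h)"
    using DERIV_pos_inc_right[OF f''] by auto
  define c where "c = min (x - a) (b - x)"
  have c: "c > 0" using x by (auto simp: c_def)
  have "f' x = 0"
    by (rule DERIV_local_max[OF f'[OF x] c]) (auto intro!: max simp: c_def abs_real_def split: if_splits)
  define h where "h = min (c/2) (e/2)"
  have "h \<le> c / 2" unfolding h_def by (rule min.cobounded1)
  moreover have "c \<le> b - x" by (auto simp: c_def)
  ultimately have h: "0 < h" "h < e" "x + h < b" using c e by (auto simp: h_def)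
  have "\<exists>z. x < z \<and> z < x + h \<and> f (x + h) - f x = (x + h - x) * f' z"
    by (rule MVT2) (use h x in \<open>auto intro!: f'\<close>)
  then obtain z where z: "x < z" "z < x + h" "f (x + h) - f x = h * f' z" by auto
  have "f' x < f' (x + (z - x))" using z h by (intro e) auto
  then have "h * f' z > 0" using h \<open>f' x = 0\<close> by simp
  then have "f (x + h) > f x" using z by linarith
  moreover have "f (x + h) \<le> f x" using h x by (intro max) auto
  ultimately show False by simp
qed

lemma derivative_nonneg_at_right_max:
  fixes f :: "real \<Rightarrow> real"
  assumes f': "(f has_real_derivative m) (at t)" and "e > 0"
    and max: "\<And>\<tau>. t - e < \<tau> \<Longrightarrow> \<tau> < t \<Longrightarrow> f \<tau> \<le> f t"
  shows "m \<ge> 0"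
proof (rule ccontr)
  assume "\<not> m \<ge> 0"
  then obtain d where d: "d > 0" "\<And>h. 0 < h \<Longrightarrow> h < d \<Longrightarrow> f t < f (t - h)"
    using DERIV_neg_dec_left[OF f'] by auto
  define h where "h = min (d/2) (e/2)"
  have "0 < h" "h < d" "h < e" using d \<open>e > 0\<close> by (auto simp: h_def min_def)
  then show False using d(2)[of h] max[of "t - h"] by auto
qed

lemma derivative_nonpos_at_left_max:
  fixes f :: "real \<Rightarrow> real"
  assumes f': "(f has_real_derivative m) (at a within {a..b})" and "a < b"
    and max: "\<And>y. y \<in> {a..b} \<Longrightarrow> f y \<le> f a"
  shows "m \<le> 0"
proof (rule ccontr)
  assume "\<not> m \<le> 0"
  then obtain d where d: "d > 0" "\<And>h. 0 < h \<Longrightarrow> a + h \<in> {a..b} \<Longrightarrow> h < d \<Longrightarrow> f a < f (a + h)"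
    using has_real_derivative_pos_inc_right[OF f'] by auto
  define h where "h = min (d/2) (b - a)"
  have "0 < h" "h < d" "a + h \<in> {a..b}" using d \<open>a < b\<close> by (auto simp: h_def min_def)
  then show False using d(2)[of h] max[of "a + h"] by auto
qed

lemma derivative_nonpos_at_right_min:
  fixes f :: "real \<Rightarrow> real"
  assumes f': "(f has_real_derivative m) (at b within {a..b})" and "c < b" "a \<le> c"
    and min: "\<And>y. y \<in> {c..b} \<Longrightarrow> f b \<le> f y"
  shows "m \<le> 0"
proof (rule ccontr)
  assume "\<not> m \<le> 0"
  then obtain d where d: "d > 0" "\<And>h. 0 < h \<Longrightarrow> b - h \<in> {a..b} \<Longrightarrow> h < d \<Longrightarrow> f (b - h) < f b"
    using has_real_derivative_pos_inc_left[OF f'] by auto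
  define h where "h = min (d/2) (b - c)"
  have "0 < h" "h < d" "b - h \<in> {c..b}" using d \<open>c < b\<close> by (auto simp: h_def min_def)
  then show False using d(2)[of h] min[of "b - h"] \<open>a \<le> c\<close> by auto
qed

lemma eventually_left_less:
  fixes l r :: "real \<Rightarrow> real"
  assumes "continuous_on {t0..T} l" "continuous_on {t0..T} r" "t \<in> {t0<..T}" "l t < r t"
  shows "\<exists>e>0. \<forall>\<tau>. t - e < \<tau> \<and> \<tau> \<le> t \<longrightarrow> t0 \<le> \<tau> \<and> l \<tau> < r \<tau>"
proof -
  have "continuous_on {t0..T} (\<lambda>\<tau>. r \<tau> - l \<tau>)" by (intro continuous_intros assms)
  then have "((\<lambda>\<tau>. r \<tau> - l \<tau>) \<longlongrightarrow> r t - l t) (at t within {t0..T})"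
    using assms by (auto simp: continuous_on_def)
  then have "eventually (\<lambda>\<tau>. 0 < r \<tau> - l \<tau>) (at t within {t0..T})"
    using assms by (intro order_tendstoD) auto
  then obtain d where d: "d > 0" "\<And>\<tau>. \<tau> \<in> {t0..T} \<Longrightarrow> \<tau> \<noteq> t \<Longrightarrow> dist \<tau> t < d \<Longrightarrow> 0 < r \<tau> - l \<tau>"
    unfolding eventually_at by auto
  show ?thesis
  proof (intro exI[of _ "min d (t - t0)"] conjI allI impI)
    show "min d (t - t0) > 0" using d assms by auto
    fix \<tau> assume *: "t - min d (t - t0) < \<tau> \<and> \<tau> \<le> t"
    then show "t0 \<le> \<tau>" using assms by auto
    show "l \<tau> < r \<tau>"
    proof (cases "\<tau> = t")
      case False then show ?thesis using d(2)[of \<tau>] * assms by (auto simp: dist_real_def)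
    qed (use assms in auto)
  qed
qed

lemma bdd_above_on_Icc:
  fixes f :: "real \<Rightarrow> real"
  assumes "continuous_on {a..b} f"
  obtains X where "\<And>t. t \<in> {a..b} \<Longrightarrow> f t \<le> X"
proof -
  have "compact (f ` {a..b})" by (intro compact_continuous_image assms) auto
  then have "bdd_above (f ` {a..b})" by (intro bounded_imp_bdd_above compact_imp_bounded)
  then show ?thesis using that unfolding bdd_above_def by (metis imageI)
qed

lemma parabolic_comparison:
  fixes z zt zx zxx :: "real \<Rightarrow> real \<Rightarrow> real" and l r :: "real \<Rightarrow> real"
  assumes D: "D \<ge> 0"
    and l: "continuous_on {t0..T} l" and r: "continuous_on {t0..T} r"
    and lr: "\<And>t. t \<in> {t0..T} \<Longrightarrow> l t < r t"
    and z_cont: "continuous_on {(t, x). t \<in> {t0..T} \<and> x \<in> {l t..r t}} (\<lambda>(t, x). z t x)"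
    and init: "\<And>x. x \<in> {l t0..r t0} \<Longrightarrow> z t0 x \<le> 0"
    and right: "\<And>t. t \<in> {t0<..T} \<Longrightarrow> z t (r t) \<le> 0"
    and left: "\<And>t. t \<in> {t0<..T} \<Longrightarrow> z t (l t) \<le> 0 \<or>
      (\<exists>e\<ge>0. (z t has_real_derivative e) (at (l t) within {l t..r t}))"
    and dt: "\<And>t x. t \<in> {t0<..T} \<Longrightarrow> x \<in> {l t<..<r t} \<Longrightarrow>
      ((\<lambda>\<tau>. z \<tau> x) has_real_derivative zt t x) (at t)"
    and dx: "\<And>t x. t \<in> {t0<..T} \<Longrightarrow> x \<in> {l t<..<r t} \<Longrightarrow>
      (z t has_real_derivative zx t x) (at x)"
    and dxx: "\<And>t x. t \<in> {t0<..T} \<Longrightarrow> x \<in> {l t<..<r t} \<Longrightarrow>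
      (zx t has_real_derivative zxx t x) (at x)"
    and ineq: "\<And>t x. t \<in> {t0<..T} \<Longrightarrow> x \<in> {l t<..<r t} \<Longrightarrow> z t x > 0 \<Longrightarrow>
      zt t x \<le> D * zxx t x + C * z t x"
    and t: "t \<in> {t0..T}" and x: "x \<in> {l t..r t}"
  shows "z t x \<le> 0"
proof (rule ccontr)
  assume "\<not> z t x \<le> 0"
  then have pos: "z t x > 0" by simp
  define S where "S = {(t, x). t \<in> {t0..T} \<and> x \<in> {l t..r t}}"
  obtain X where X: "\<And>t. t \<in> {t0..T} \<Longrightarrow> r t \<le> X" using bdd_above_on_Icc[OF r] by blast
  have S: "compact S"
  proof -
    have lc: "continuous_on ({t0..T} \<times> {0..1}) (\<lambda>p. l (fst p))"
         "continuous_on ({t0..T} \<times> {0..1}) (\<lambda>p. r (fst p))"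
      by (intro continuous_on_compose2[OF l] continuous_on_compose2[OF r] continuous_intros; auto)+
    have "S = (\<lambda>p. (fst p, l (fst p) + snd p * (r (fst p) - l (fst p)))) ` ({t0..T} \<times> {0..1})"
    proof (intro equalityI subsetI)
      fix p assume "p \<in> S"
      then obtain \<tau> y where p: "p = (\<tau>, y)" "\<tau> \<in> {t0..T}" "y \<in> {l \<tau>..r \<tau>}" by (auto simp: S_def)
      with lr[OF p(2)] show "p \<in> (\<lambda>p. (fst p, l (fst p) + snd p * (r (fst p) - l (fst p)))) ` ({t0..T} \<times> {0..1})"
        by (intro image_eqI[where x = "(\<tau>, (y - l \<tau>) / (r \<tau> - l \<tau>))"]) (auto simp: field_simps)
    next
      fix p assume "p \<in> (\<lambda>p. (fst p, l (fst p) + snd p * (r (fst p) - l (fst p)))) ` ({t0..T} \<times> {0..1})"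
      then obtain p' where p': "p = (fst p', l (fst p') + snd p' * (r (fst p') - l (fst p')))"
        "p' \<in> {t0..T} \<times> {0..1}" by (rule imageE)
      define \<tau> u where "\<tau> = fst p'" and "u = snd p'"
      have p: "p = (\<tau>, l \<tau> + u * (r \<tau> - l \<tau>))" "\<tau> \<in> {t0..T}" "u \<in> {0..1}"
        using p' by (auto simp: \<tau>_def u_def mem_Times_iff)
      have "0 \<le> u * (r \<tau> - l \<tau>)" "u * (r \<tau> - l \<tau>) \<le> 1 * (r \<tau> - l \<tau>)"
        using p lr[OF p(2)] by (auto intro!: mult_right_mono)
      then show "p \<in> S" using p by (auto simp: S_def)
    qed
    also have "compact \<dots>"
      by (intro compact_continuous_image compact_Times continuous_intros lc) auto
    finally show ?thesis .
  qed
  define \<Lambda> where "\<Lambda> = C + 1"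
  define \<eta> where "\<eta> = exp (- \<Lambda> * t) * z t x / (2 * (X + 1 - x))"
  have "X + 1 - x > 0" using X[OF t] x by auto
  moreover have "c / (2 * y) * y = c / 2" if "y > 0" for c y :: real using that by simp
  ultimately have \<eta>: "\<eta> > 0" "\<eta> * (X + 1 - x) < exp (- \<Lambda> * t) * z t x"
    using pos by (auto simp only: \<eta>_def) auto
  \<comment> \<open>The linear term makes the derivative at the left endpoint strictly positive, the factor
    \<open>exp\<close> absorbs the zeroth-order term.\<close>
  define Z where "Z t x = exp (- \<Lambda> * t) * z t x - \<eta> * (X + 1 - x)" for t x
  have "continuous_on S (\<lambda>p. exp (- \<Lambda> * fst p) * (\<lambda>(t,x). z t x) p - \<eta> * (X + 1 - snd p))"
    using z_cont unfolding S_def by (intro continuous_intros)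
  then have "continuous_on S (\<lambda>(t, x). Z t x)" by (simp add: Z_def case_prod_unfold)
  moreover have S_ne: "S \<noteq> {}" using t x by (auto simp: S_def)
  ultimately obtain p where "p \<in> S" "\<forall>p'\<in>S. (\<lambda>(t, x). Z t x) p' \<le> (\<lambda>(t, x). Z t x) p"
    using continuous_attains_sup[OF S] S_ne by metis
  then obtain t1 x1 where p: "t1 \<in> {t0..T}" "x1 \<in> {l t1..r t1}"
    and max: "\<And>\<tau> y. \<tau> \<in> {t0..T} \<Longrightarrow> y \<in> {l \<tau>..r \<tau>} \<Longrightarrow> Z \<tau> y \<le> Z t1 x1"
    by (auto simp: S_def)
  have "Z t x > 0" using \<eta> by (simp add: Z_def)
  then have Z1: "Z t1 x1 > 0" using max[OF t x] by simp
  moreover have "\<eta> * (X + 1 - x1) > 0" using \<eta> X[OF p(1)] p(2) by auto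
  ultimately have "exp (- \<Lambda> * t1) * z t1 x1 > 0" unfolding Z_def by linarith
  then have z1: "z t1 x1 > 0" by (simp add: zero_less_mult_iff)
  have t1: "t1 \<in> {t0<..T}" using init[of x1] z1 p by (cases "t1 = t0") auto
  have "x1 \<noteq> r t1" using right[OF t1] z1 by auto
  have "x1 \<noteq> l t1"
  proof
    assume [simp]: "x1 = l t1"
    obtain e where e: "e \<ge> 0" "(z t1 has_real_derivative e) (at (l t1) within {l t1..r t1})"
      using left[OF t1] z1 by auto
    have "(Z t1 has_real_derivative (exp (- \<Lambda> * t1) * e + \<eta>)) (at (l t1) within {l t1..r t1})"
      unfolding Z_def[abs_def] by (auto intro!: derivative_eq_intros e)
    then have "exp (- \<Lambda> * t1) * e + \<eta> \<le> 0"
      by (rule derivative_nonpos_at_left_max) (use lr[OF p(1)] max p in auto)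
    moreover have "exp (- \<Lambda> * t1) * e \<ge> 0" using e by auto
    ultimately show False using \<eta> by linarith
  qed
  then have x1: "x1 \<in> {l t1<..<r t1}" using p \<open>x1 \<noteq> r t1\<close> by auto
  have "exp (- \<Lambda> * t1) * zxx t1 x1 \<le> 0"
  proof (rule second_derivative_nonpos_at_max[OF x1])
    show "(Z t1 has_real_derivative (exp (- \<Lambda> * t1) * zx t1 y + \<eta>)) (at y)"
      if "y \<in> {l t1<..<r t1}" for y
      unfolding Z_def[abs_def] by (auto intro!: derivative_eq_intros dx[OF t1 that])
    show "((\<lambda>y. exp (- \<Lambda> * t1) * zx t1 y + \<eta>) has_real_derivative exp (- \<Lambda> * t1) * zxx t1 x1) (at x1)"
      by (auto intro!: derivative_eq_intros dxx[OF t1 x1])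
    show "Z t1 y \<le> Z t1 x1" if "y \<in> {l t1<..<r t1}" for y using max p that by auto
  qed
  then have xx: "zxx t1 x1 \<le> 0" by (simp add: mult_le_0_iff)
  obtain e where e: "e > 0" "\<And>\<tau>. t1 - e < \<tau> \<Longrightarrow> \<tau> \<le> t1 \<Longrightarrow> t0 \<le> \<tau> \<and> l \<tau> < x1"
    using eventually_left_less[OF l continuous_on_const t1, of x1] x1 by auto
  obtain e' where e': "e' > 0" "\<And>\<tau>. t1 - e' < \<tau> \<Longrightarrow> \<tau> \<le> t1 \<Longrightarrow> t0 \<le> \<tau> \<and> x1 < r \<tau>"
    using eventually_left_less[OF continuous_on_const r t1, of x1] x1 by auto
  have "exp (- \<Lambda> * t1) * (zt t1 x1 - \<Lambda> * z t1 x1) \<ge> 0"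
  proof (rule derivative_nonneg_at_right_max)
    show "((\<lambda>\<tau>. Z \<tau> x1) has_real_derivative exp (- \<Lambda> * t1) * (zt t1 x1 - \<Lambda> * z t1 x1)) (at t1)"
      unfolding Z_def[abs_def] by (auto intro!: derivative_eq_intros dt[OF t1 x1] simp: algebra_simps)
    show "min e e' > 0" using e e' by auto
    show "Z \<tau> x1 \<le> Z t1 x1" if "t1 - min e e' < \<tau>" "\<tau> < t1" for \<tau>
    proof -
      have "t1 - e < \<tau>" "t1 - e' < \<tau>" using that by auto
      then show ?thesis using e(2)[of \<tau>] e'(2)[of \<tau>] that t1 by (intro max) auto
    qed
  qed
  then have "zt t1 x1 \<ge> \<Lambda> * z t1 x1" by (simp add: zero_le_mult_iff)
  with ineq[OF t1 x1 z1] xx D z1 show False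
    using mult_nonneg_nonpos[OF D xx] by (simp add: \<Lambda>_def algebra_simps)
qed

section \<open>Free boundary components\<close>

locale free_boundary =
  fixes D k :: real and w q wx wxx wt :: "real \<Rightarrow> real \<Rightarrow> real" and s :: "real \<Rightarrow> real"
  assumes D_pos: "D > 0" and k_pos: "k > 0"
    and s_cont: "continuous_on {0..} s"
    and s_pos: "t \<ge> 0 \<Longrightarrow> s t > 0"
    and w_cont: "continuous_on ({0..} \<times> {0..}) (\<lambda>(t, x). w t x)"
    and q_cont: "continuous_on ({0..} \<times> {0..}) (\<lambda>(t, x). q t x)"
    and w_zero: "t \<ge> 0 \<Longrightarrow> x \<ge> s t \<Longrightarrow> w t x = 0"
    and wx_cont: "continuous_on {(t, x). t > 0 \<and> 0 \<le> x \<and> x \<le> s t} (\<lambda>(t, x). wx t x)"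
    and w_x: "t > 0 \<Longrightarrow> x \<in> {0..s t} \<Longrightarrow> (w t has_real_derivative wx t x) (at x within {0..s t})"
    and w_xx: "t > 0 \<Longrightarrow> x \<in> {0<..<s t} \<Longrightarrow> (wx t has_real_derivative wxx t x) (at x)"
    and w_t: "t > 0 \<Longrightarrow> x \<in> {0<..<s t} \<Longrightarrow> ((\<lambda>\<tau>. w \<tau> x) has_real_derivative wt t x) (at t)"
    and pde: "t > 0 \<Longrightarrow> x \<in> {0<..<s t} \<Longrightarrow> wt t x = D * wxx t x + w t x * q t x"
    and neumann: "t > 0 \<Longrightarrow> wx t 0 = 0"
    and stefan: "t > 0 \<Longrightarrow> (s has_real_derivative - k * wx t (s t)) (at t)"
    and init_pos: "x \<in> {0..<s 0} \<Longrightarrow> w 0 x > 0"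
begin

lemma w_x_interior: "t > 0 \<Longrightarrow> x \<in> {0<..<s t} \<Longrightarrow> (w t has_real_derivative wx t x) (at x)"
  using w_x[of t x] by (simp add: at_within_Icc_at)

lemma s_cont_on: "0 \<le> t0 \<Longrightarrow> continuous_on {t0..T} s"
  by (rule continuous_on_subset[OF s_cont]) auto

lemma w_cont_on: "A \<subseteq> {0..} \<times> {0..} \<Longrightarrow> continuous_on A (\<lambda>p. w (fst p) (snd p))"
  using continuous_on_subset[OF w_cont] by (simp add: case_prod_unfold)

lemma w_cont_comp:
  assumes "continuous_on A f" "continuous_on A g" "\<And>p. p \<in> A \<Longrightarrow> 0 \<le> f p \<and> 0 \<le> g p"
  shows "continuous_on A (\<lambda>p. w (f p) (g p))"
  using continuous_on_compose2[OF w_cont continuous_on_Pair[OF assms(1,2)]] assms(3)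
  by (auto simp: image_subset_iff)

lemma w_nonneg:
  assumes "t \<ge> 0" "x \<ge> 0"
  shows "w t x \<ge> 0"
proof (cases "x \<le> s t")
  case True
  obtain X where X: "\<And>\<tau>. \<tau> \<in> {0..t} \<Longrightarrow> s \<tau> \<le> X" using bdd_above_on_Icc[OF s_cont_on[of 0 t]] by auto
  have "continuous_on ({0..t} \<times> {0..X}) (\<lambda>(t, x). q t x)"
    by (rule continuous_on_subset[OF q_cont]) auto
  then have "compact ((\<lambda>(t, x). q t x) ` ({0..t} \<times> {0..X}))"
    by (intro compact_continuous_image compact_Times) auto
  then have "bdd_above ((\<lambda>(t, x). q t x) ` ({0..t} \<times> {0..X}))"
    by (intro bounded_imp_bdd_above compact_imp_bounded)
  then obtain C where C: "\<And>\<tau> y. \<tau> \<in> {0..t} \<Longrightarrow> y \<in> {0..X} \<Longrightarrow> q \<tau> y \<le> C"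
    unfolding bdd_above_def by fastforce
  have "- w t x \<le> 0"
  proof (rule parabolic_comparison[where z = "\<lambda>t x. - w t x" and l = "\<lambda>_. 0" and r = s
        and zt = "\<lambda>t x. - wt t x" and zx = "\<lambda>t x. - wx t x" and zxx = "\<lambda>t x. - wxx t x"
        and ?t0.0 = 0 and T = t and C = C])
    show "D \<ge> 0" using D_pos by simp
    show "continuous_on {(\<tau>, x). \<tau> \<in> {0..t} \<and> x \<in> {0..s \<tau>}} (\<lambda>(t, x). - w t x)"
      unfolding case_prod_unfold by (intro continuous_intros w_cont_on) auto
    show "- w 0 x \<le> 0" if "x \<in> {0..s 0}" for x
      using init_pos[of x] w_zero[of 0 x] that by (cases "x < s 0") auto
    show "- wt \<tau> y \<le> D * - wxx \<tau> y + C * - w \<tau> y"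
      if "\<tau> \<in> {0<..t}" "y \<in> {0<..<s \<tau>}" "- w \<tau> y > 0" for \<tau> y
    proof -
      have "q \<tau> y \<le> C" using that X[of \<tau>] by (intro C) auto
      then have "q \<tau> y * - w \<tau> y \<le> C * - w \<tau> y" using that by (intro mult_right_mono) auto
      then show ?thesis using pde[of \<tau> y] that by (simp add: algebra_simps)
    qed
    show "- w \<tau> 0 \<le> 0 \<or> (\<exists>e\<ge>0. ((\<lambda>x. - w \<tau> x) has_real_derivative e) (at 0 within {0..s \<tau>}))"
      if "\<tau> \<in> {0<..t}" for \<tau>
      using DERIV_minus[OF w_x[of \<tau> 0]] neumann[of \<tau>] s_pos[of \<tau>] that by auto
  qed (use assms True in \<open>auto intro!: s_cont_on s_pos derivative_intros w_t w_x_interior w_xx simp: w_zero\<close>)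
  then show ?thesis by simp
qed (use assms w_zero[of t x] in auto)

lemma wx_boundary_nonpos:
  assumes "t > 0"
  shows "wx t (s t) \<le> 0"
  by (rule derivative_nonpos_at_right_min[OF w_x, where c = 0])
    (use assms s_pos[of t] w_nonneg[of t] w_zero[of t "s t"] in auto)

lemma speed_nonneg: "t > 0 \<Longrightarrow> - k * wx t (s t) \<ge> 0"
  using wx_boundary_nonpos[of t] k_pos by (simp add: mult_le_0_iff)

lemma s_mono:
  assumes "0 \<le> t" "t \<le> t'"
  shows "s t \<le> s t'"
proof (rule DERIV_nonneg_imp_increasing_open[OF \<open>t \<le> t'\<close>])
  show "\<exists>y. (s has_real_derivative y) (at \<tau>) \<and> y \<ge> 0" if "t < \<tau>" "\<tau> < t'" for \<tau>
    using stefan[of \<tau>] speed_nonneg[of \<tau>] that assms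
    by (intro exI[of _ "- k * wx \<tau> (s \<tau>)"] conjI) auto
qed (use assms s_cont_on in auto)

lemma upper_bound:
  fixes Y Y' :: "real \<Rightarrow> real"
  assumes "t0 \<ge> 0" and Y: "\<And>t. t \<ge> t0 \<Longrightarrow> (Y has_real_derivative Y' t) (at t)"
    and Y_nonneg: "\<And>t. t \<ge> t0 \<Longrightarrow> Y t \<ge> 0"
    and init: "\<And>x. x \<ge> 0 \<Longrightarrow> w t0 x \<le> Y t0"
    and super: "\<And>t x. t > t0 \<Longrightarrow> x \<in> {0<..<s t} \<Longrightarrow> w t x > Y t \<Longrightarrow> w t x * q t x \<le> Y' t"
    and "t \<ge> t0" "x \<ge> 0"
  shows "w t x \<le> Y t"
proof (cases "x \<le> s t")
  case True
  have Yc: "continuous_on {t0..t} Y" by (rule DERIV_continuous_on) (use Y in \<open>auto intro: DERIV_subset\<close>)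
  have "w t x - Y t \<le> 0"
  proof (rule parabolic_comparison[where z = "\<lambda>t x. w t x - Y t" and l = "\<lambda>_. 0" and r = s
        and zt = "\<lambda>t x. wt t x - Y' t" and zx = wx and zxx = wxx
        and ?t0.0 = t0 and T = t and C = 0])
    show "D \<ge> 0" using D_pos by simp
    show "continuous_on {(\<tau>, x). \<tau> \<in> {t0..t} \<and> x \<in> {0..s \<tau>}} (\<lambda>(t, x). w t x - Y t)"
      unfolding case_prod_unfold using \<open>t0 \<ge> 0\<close>
      by (intro continuous_intros w_cont_on continuous_on_compose2[OF Yc]) auto
    show "wt \<tau> y - Y' \<tau> \<le> D * wxx \<tau> y + 0 * (w \<tau> y - Y \<tau>)"
      if "\<tau> \<in> {t0<..t}" "y \<in> {0<..<s \<tau>}" "w \<tau> y - Y \<tau> > 0" for \<tau> y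
      using pde[of \<tau> y] super[of \<tau> y] that \<open>t0 \<ge> 0\<close> by simp
    show "w \<tau> 0 - Y \<tau> \<le> 0 \<or> (\<exists>e\<ge>0. ((\<lambda>x. w \<tau> x - Y \<tau>) has_real_derivative e) (at 0 within {0..s \<tau>}))"
      if "\<tau> \<in> {t0<..t}" for \<tau>
    proof -
      have "((\<lambda>x. w \<tau> x - Y \<tau>) has_real_derivative wx \<tau> 0 - 0) (at 0 within {0..s \<tau>})"
        using that \<open>t0 \<ge> 0\<close> s_pos[of \<tau>] by (intro derivative_intros w_x) auto
      then show ?thesis using neumann[of \<tau>] that \<open>t0 \<ge> 0\<close> by auto
    qed
    show "((\<lambda>x. w \<tau> x - Y \<tau>) has_real_derivative wx \<tau> y) (at y)"
      if "\<tau> \<in> {t0<..t}" "y \<in> {0<..<s \<tau>}" for \<tau> y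
      using that \<open>t0 \<ge> 0\<close> by (auto intro!: derivative_eq_intros w_x_interior)
  qed (use assms True in \<open>auto intro!: s_cont_on s_pos derivative_intros w_t w_xx simp: w_zero\<close>)
  then show ?thesis by simp
qed (use assms w_zero[of t x] Y_nonneg[of t] in auto)

lemma bounded_by_carrying_capacity:
  assumes "\<And>t x. t \<ge> 0 \<Longrightarrow> x \<ge> 0 \<Longrightarrow> q t x \<le> A - w t x"
  shows "\<exists>M. \<forall>t\<ge>0. \<forall>x\<ge>0. w t x \<le> M"
proof -
  have "continuous_on {0..s 0} (w 0)" by (rule w_cont_comp) (auto intro!: continuous_intros)
  then obtain M0 where M0: "\<And>x. x \<in> {0..s 0} \<Longrightarrow> w 0 x \<le> M0" using bdd_above_on_Icc by blast
  define M where "M = max A (max M0 0)"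
  have "w t x \<le> M" if "t \<ge> 0" "x \<ge> 0" for t x
  proof (rule upper_bound[where ?t0.0 = 0 and Y = "\<lambda>_. M" and Y' = "\<lambda>_. 0"])
    show "w 0 x \<le> M" if "x \<ge> 0" for x
      using M0[of x] w_zero[of 0 x] that by (cases "x \<le> s 0") (auto simp: M_def)
    show "w t x * q t x \<le> 0" if "t > 0" "x \<in> {0<..<s t}" "w t x > M" for t x
      using assms[of t x] that by (intro mult_nonneg_nonpos) (auto simp: M_def)
  qed (use that in \<open>auto simp: M_def\<close>)
  then show ?thesis by blast
qed

end

locale bounded_free_boundary = free_boundary +
  fixes M Q :: real
  assumes w_le: "t \<ge> 0 \<Longrightarrow> x \<ge> 0 \<Longrightarrow> w t x \<le> M"
    and q_le: "t \<ge> 0 \<Longrightarrow> x \<ge> 0 \<Longrightarrow> \<bar>q t x\<bar> \<le> Q"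
begin

lemma M_nonneg: "M \<ge> 0" using w_le[of 0 0] w_nonneg[of 0 0] by simp

lemma Q_nonneg: "Q \<ge> 0" using q_le[of 0 0] by simp

lemma reaction_bound:
  assumes "t \<ge> 0" "x \<ge> 0"
  shows "\<bar>w t x * q t x\<bar> \<le> M * Q"
  using assms w_nonneg[of t x] w_le[of t x] q_le[of t x] unfolding abs_mult
  by (intro mult_mono) auto

lemma boundary_barrier:
  assumes B: "B \<ge> M * Q / D" "B \<ge> 0" and A: "A \<ge> M + B" "A \<ge> 2 * B" and "t0 > 0"
    and init: "\<And>x. x \<in> {0..s t0} \<Longrightarrow> w t0 x \<le> (A - B) * (s t0 - x)"
    and "t \<ge> t0" and x: "x \<in> {0..s t}" "s t - x \<le> 1"
  shows "w t x \<le> A * (s t - x) - B * (s t - x)\<^sup>2"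
proof -
  define z where "z t x = w t x - (A * (s t - x) - B * (s t - x)\<^sup>2)" for t x
  have gap: "0 \<le> A - 2 * B * r" if "0 \<le> r" "r \<le> 1" for r
  proof -
    have "2 * B * r \<le> 2 * B * 1" using that B by (intro mult_left_mono) auto
    then show ?thesis using A by simp
  qed
  have "z t x \<le> 0"
  proof (rule parabolic_comparison[where z = z and l = "\<lambda>t. max 0 (s t - 1)" and r = s
        and zt = "\<lambda>t x. wt t x - (A - 2 * B * (s t - x)) * (- k * wx t (s t))"
        and zx = "\<lambda>t x. wx t x + A - 2 * B * (s t - x)" and zxx = "\<lambda>t x. wxx t x + 2 * B"
        and ?t0.0 = t0 and T = t and C = 0])
    show "D \<ge> 0" using D_pos by simp
    show "continuous_on {t0..t} (\<lambda>t. max 0 (s t - 1))"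
      using \<open>t0 > 0\<close> by (intro continuous_intros s_cont_on) auto
    show "continuous_on {(\<tau>, x). \<tau> \<in> {t0..t} \<and> x \<in> {max 0 (s \<tau> - 1)..s \<tau>}} (\<lambda>(t, x). z t x)"
      unfolding case_prod_unfold z_def using \<open>t0 > 0\<close>
      by (intro continuous_intros w_cont_on continuous_on_compose2[OF s_cont]) auto
    show "z t0 x \<le> 0" if "x \<in> {max 0 (s t0 - 1)..s t0}" for x
    proof -
      have "(s t0 - x)\<^sup>2 \<le> s t0 - x" using that power_le_one[of "s t0 - x" 1]
        by (auto simp: power2_eq_square intro!: mult_left_le)
      then have "B * (s t0 - x)\<^sup>2 \<le> B * (s t0 - x)" using B by (intro mult_left_mono)
      then show ?thesis using init[of x] that by (simp add: z_def algebra_simps)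
    qed
    show "wt \<tau> y - (A - 2 * B * (s \<tau> - y)) * (- k * wx \<tau> (s \<tau>)) \<le> D * (wxx \<tau> y + 2 * B) + 0 * z \<tau> y"
      if "\<tau> \<in> {t0<..t}" "y \<in> {max 0 (s \<tau> - 1)<..<s \<tau>}" for \<tau> y
    proof -
      have pos: "\<tau> > 0" "y \<in> {0<..<s \<tau>}" using that \<open>t0 > 0\<close> by auto
      have "(A - 2 * B * (s \<tau> - y)) * (- k * wx \<tau> (s \<tau>)) \<ge> 0"
        using speed_nonneg[OF pos(1)] gap[of "s \<tau> - y"] that
        by (intro mult_nonneg_nonneg[of "A - 2 * B * (s \<tau> - y)"]) auto
      moreover have "w \<tau> y * q \<tau> y \<le> M * Q" using reaction_bound[of \<tau> y] pos by auto
      moreover have "M * Q \<le> D * B" using B D_pos by (simp add: field_simps)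
      moreover have "D * B \<ge> 0" using D_pos B by simp
      ultimately show ?thesis using pde[OF pos] by (simp add: algebra_simps)
    qed
    show "z \<tau> (max 0 (s \<tau> - 1)) \<le> 0 \<or>
      (\<exists>e\<ge>0. (z \<tau> has_real_derivative e) (at (max 0 (s \<tau> - 1)) within {max 0 (s \<tau> - 1)..s \<tau>}))"
      if "\<tau> \<in> {t0<..t}" for \<tau>
    proof (cases "s \<tau> \<ge> 1")
      case True
      then show ?thesis using w_le[of \<tau> "s \<tau> - 1"] A that \<open>t0 > 0\<close> by (simp add: z_def)
    next
      case False
      have "(z \<tau> has_real_derivative wx \<tau> 0 + (A - 2 * B * s \<tau>)) (at 0 within {0..s \<tau>})"
        unfolding z_def[abs_def] using that \<open>t0 > 0\<close> s_pos[of \<tau>]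
        by (auto intro!: derivative_eq_intros w_x simp: algebra_simps)
      then show ?thesis using False gap[of "s \<tau>"] neumann[of \<tau>] that \<open>t0 > 0\<close> s_pos[of \<tau>] by auto
    qed
    show "(z \<tau> has_real_derivative wx \<tau> y + A - 2 * B * (s \<tau> - y)) (at y)"
      if "\<tau> \<in> {t0<..t}" "y \<in> {max 0 (s \<tau> - 1)<..<s \<tau>}" for \<tau> y
      unfolding z_def[abs_def] using that \<open>t0 > 0\<close>
      by (auto intro!: derivative_eq_intros w_x_interior simp: algebra_simps)
    show "((\<lambda>y. wx \<tau> y + A - 2 * B * (s \<tau> - y)) has_real_derivative wxx \<tau> y + 2 * B) (at y)"
      if "\<tau> \<in> {t0<..t}" "y \<in> {max 0 (s \<tau> - 1)<..<s \<tau>}" for \<tau> y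
      using that \<open>t0 > 0\<close> by (auto intro!: derivative_eq_intros w_xx simp: algebra_simps)
    show "((\<lambda>\<tau>. z \<tau> y) has_real_derivative wt \<tau> y - (A - 2 * B * (s \<tau> - y)) * (- k * wx \<tau> (s \<tau>))) (at \<tau>)"
      if "\<tau> \<in> {t0<..t}" "y \<in> {max 0 (s \<tau> - 1)<..<s \<tau>}" for \<tau> y
      unfolding z_def[abs_def] using that \<open>t0 > 0\<close>
      by (auto intro!: derivative_eq_intros w_t stefan simp: algebra_simps)
  qed (use assms in \<open>auto intro!: s_cont_on s_pos simp: z_def w_zero\<close>)
  then show ?thesis by (simp add: z_def)
qed

text \<open>
  Doubling the variables: \<open>w t x - w t y\<close> solves a heat equation in \<open>(x, y)\<close> and is compared with a
  concave function of \<open>x - y\<close>, which turns the sup bound on \<open>w\<close> into a Lipschitz bound.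
\<close>

lemma doubling:
  assumes B: "B > M * Q / D" and A: "A \<ge> M + B" "A > 2 * B" and "t0 > 0"
    and init: "\<And>x y. x \<in> {0..s t0} \<Longrightarrow> y \<in> {0..s t0} \<Longrightarrow> \<bar>w t0 x - w t0 y\<bar> \<le> (A - B) * \<bar>x - y\<bar>"
    and \<sigma>: "\<sigma> = 1 \<or> \<sigma> = -1"
    and t: "t \<ge> t0" and x: "x \<le> s t" and y: "0 \<le> y" and yx: "y \<le> x" "x - y \<le> 1"
  shows "\<sigma> * (w t x - w t y) \<le> A * (x - y) - B * (x - y)\<^sup>2"
proof (rule ccontr)
  assume neg: "\<not> ?thesis"
  have "M * Q / D \<ge> 0" using M_nonneg Q_nonneg D_pos by simp
  with B have B0: "B > 0" by linarith
  define f where "f t x y = \<sigma> * (w t x - w t y) - (A * (x - y) - B * (x - y)\<^sup>2)" for t x y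
  obtain X where X: "\<And>\<tau>. \<tau> \<in> {t0..t} \<Longrightarrow> s \<tau> \<le> X"
    using bdd_above_on_Icc[OF s_cont_on[of t0 t]] \<open>t0 > 0\<close> by auto
  define R where "R = {t0..t} \<times> {0..X} \<times> {0..X}"
  define S where "S = R \<inter> {p \<in> R. fst (snd p) \<le> s (fst p)} \<inter> {p. snd (snd p) \<le> fst (snd p)}
      \<inter> {p. fst (snd p) - snd (snd p) \<le> 1}"
  have mem: "(\<tau>, x, y) \<in> S \<longleftrightarrow> \<tau> \<in> {t0..t} \<and> 0 \<le> y \<and> y \<le> x \<and> x \<le> s \<tau> \<and> x - y \<le> 1" for \<tau> x y
    using X[of \<tau>] by (auto simp: S_def R_def)
  have R: "compact R" unfolding R_def by (intro compact_Times) auto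
  have sR: "continuous_on R (\<lambda>p. s (fst p))"
    by (rule continuous_on_compose2[OF s_cont]) (use \<open>t0 > 0\<close> in \<open>auto simp: R_def intro!: continuous_intros\<close>)
  have "closed {p \<in> R. fst (snd p) \<le> s (fst p)}"
    using R sR by (intro continuous_on_closed_Collect_le) (auto intro!: continuous_intros compact_imp_closed)
  then have "compact S" unfolding S_def
    by (intro compact_Int_closed R closed_Collect_le continuous_intros)
  moreover have "(t, x, y) \<in> S" using t x y yx by (simp add: mem)
  moreover have "continuous_on S (\<lambda>p. f (fst p) (fst (snd p)) (snd (snd p)))"
    unfolding f_def by (intro continuous_intros w_cont_comp) (use \<open>t0 > 0\<close> in \<open>auto simp: S_def R_def\<close>)
  ultimately have "\<exists>p\<in>S. \<forall>p'\<in>S.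
      f (fst p') (fst (snd p')) (snd (snd p')) \<le> f (fst p) (fst (snd p)) (snd (snd p))"
    by (intro continuous_attains_sup) auto
  then obtain p where "p \<in> S" "\<And>p'. p' \<in> S \<Longrightarrow>
      f (fst p') (fst (snd p')) (snd (snd p')) \<le> f (fst p) (fst (snd p)) (snd (snd p))"
    by blast
  then obtain t1 x1 y1 where p: "t1 \<in> {t0..t}" "0 \<le> y1" "y1 \<le> x1" "x1 \<le> s t1" "x1 - y1 \<le> 1"
    and "\<And>p'. p' \<in> S \<Longrightarrow> f (fst p') (fst (snd p')) (snd (snd p')) \<le> f t1 x1 y1"
    by (cases p) (auto simp: mem)
  then have max: "f \<tau> x y \<le> f t1 x1 y1" if "\<tau> \<in> {t0..t}" "0 \<le> y" "y \<le> x" "x \<le> s \<tau>" "x - y \<le> 1" for \<tau> x y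
    using that mem by fastforce
  have pos: "f t1 x1 y1 > 0" using max[of t y x] t x y yx neg by (simp add: f_def)
  have t1pos: "t1 > 0" using p \<open>t0 > 0\<close> by auto
  have "x1 \<noteq> y1" using pos by (auto simp: f_def)
  then have yx1: "y1 < x1" using p by simp
  have abs_le: "\<sigma> * r \<le> \<bar>r\<bar>" for r using \<sigma> by auto
  have "x1 - y1 \<noteq> 1"
  proof
    assume *: "x1 - y1 = 1"
    have "\<bar>w t1 x1 - w t1 y1\<bar> \<le> M"
      using w_le[of t1 x1] w_le[of t1 y1] w_nonneg[of t1 x1] w_nonneg[of t1 y1] p t1pos by auto
    then show False using abs_le[of "w t1 x1 - w t1 y1"] pos A * by (simp add: f_def)
  qed
  then have yx2: "x1 - y1 < 1" using p by simp
  have sq: "B * (x1 - y1)\<^sup>2 \<le> B * (x1 - y1)"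
    using B0 yx1 yx2 by (auto simp: power2_eq_square intro!: mult_left_le)
  have "t1 \<noteq> t0"
  proof
    assume [simp]: "t1 = t0"
    have "\<sigma> * (w t0 x1 - w t0 y1) \<le> (A - B) * (x1 - y1)"
      using abs_le[of "w t0 x1 - w t0 y1"] init[of x1 y1] p yx1 by auto
    then show False using pos sq by (simp add: f_def algebra_simps)
  qed
  then have t1: "t1 \<in> {t0<..t}" using p by auto
  have slope: "A - 2 * B * (x1 - y1) > 0"
  proof -
    have "2 * B * (x1 - y1) \<le> 2 * B * 1" using B0 yx2 by (intro mult_left_mono) auto
    then show ?thesis using A by simp
  qed
  have "x1 \<noteq> s t1"
  proof
    assume *: "x1 = s t1"
    have "w t1 y1 \<le> A * (s t1 - y1) - B * (s t1 - y1)\<^sup>2"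
    proof (rule boundary_barrier[where ?t0.0 = t0])
      show "w t0 x \<le> (A - B) * (s t0 - x)" if "x \<in> {0..s t0}" for x
        using init[of x "s t0"] w_zero[of t0 "s t0"] s_pos[of t0] that \<open>t0 > 0\<close> by auto
    qed (use A B B0 p * t1 \<open>t0 > 0\<close> in auto)
    moreover have "w t1 x1 = 0" using * w_zero t1pos by simp
    moreover have "B * (x1 - y1) \<le> A * (x1 - y1)" using yx1 A B0 by (intro mult_right_mono) auto
    then have "A * (x1 - y1) \<ge> B * (x1 - y1)\<^sup>2" using sq by (rule order_trans[rotated])
    moreover have "\<sigma> * - w t1 y1 \<le> max 0 (w t1 y1)" using \<sigma> w_nonneg[of t1 y1] p t1pos by auto
    ultimately show False using pos * by (simp add: f_def)
  qed
  then have x1: "x1 \<in> {0<..<s t1}" "x1 \<in> {y1<..<min (s t1) (y1 + 1)}" using p yx1 yx2 by auto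
  have "y1 \<noteq> 0"
  proof
    assume [simp]: "y1 = 0"
    have "(f t1 x1 has_real_derivative - \<sigma> * wx t1 0 + (A - 2 * B * x1)) (at 0 within {0..s t1})"
      unfolding f_def[abs_def] using t1pos s_pos[of t1]
      by (auto intro!: derivative_eq_intros w_x simp: algebra_simps)
    then have "(f t1 x1 has_real_derivative A - 2 * B * x1) (at 0 within {0..x1})"
      using neumann[OF t1pos] p by (auto intro: DERIV_subset)
    then have "A - 2 * B * x1 \<le> 0"
      by (rule derivative_nonpos_at_left_max) (use p yx1 max[of t1 _ x1] in auto)
    then show False using slope by simp
  qed
  then have y1: "y1 \<in> {0<..<s t1}" "y1 \<in> {max 0 (x1 - 1)<..<x1}" using p yx1 yx2 by auto
  have "\<sigma> * wxx t1 x1 + 2 * B \<le> 0"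
  proof (rule second_derivative_nonpos_at_max[OF x1(2)])
    show "((\<lambda>x. f t1 x y1) has_real_derivative \<sigma> * wx t1 x - A + 2 * B * (x - y1)) (at x)"
      if "x \<in> {y1<..<min (s t1) (y1 + 1)}" for x
      unfolding f_def[abs_def] using that t1pos y1
      by (auto intro!: derivative_eq_intros w_x_interior simp: algebra_simps)
    show "((\<lambda>x. \<sigma> * wx t1 x - A + 2 * B * (x - y1)) has_real_derivative \<sigma> * wxx t1 x1 + 2 * B) (at x1)"
      using t1pos x1 by (auto intro!: derivative_eq_intros w_xx simp: algebra_simps)
  qed (use p in \<open>auto intro!: max\<close>)
  moreover have "- \<sigma> * wxx t1 y1 + 2 * B \<le> 0"
  proof (rule second_derivative_nonpos_at_max[OF y1(2)])
    show "(f t1 x1 has_real_derivative - \<sigma> * wx t1 y + A - 2 * B * (x1 - y)) (at y)"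
      if "y \<in> {max 0 (x1 - 1)<..<x1}" for y
      unfolding f_def[abs_def] using that t1pos x1
      by (auto intro!: derivative_eq_intros w_x_interior simp: algebra_simps)
    show "((\<lambda>y. - \<sigma> * wx t1 y + A - 2 * B * (x1 - y)) has_real_derivative - \<sigma> * wxx t1 y1 + 2 * B) (at y1)"
      using t1pos y1 by (auto intro!: derivative_eq_intros w_xx simp: algebra_simps)
  qed (use p in \<open>auto intro!: max\<close>)
  ultimately have "D * (\<sigma> * wxx t1 x1 - \<sigma> * wxx t1 y1 + 4 * B) \<le> 0"
    using D_pos by (simp add: mult_le_0_iff)
  moreover obtain e where e: "e > 0" "\<And>\<tau>. t1 - e < \<tau> \<Longrightarrow> \<tau> \<le> t1 \<Longrightarrow> t0 \<le> \<tau> \<and> x1 < s \<tau>"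
    using eventually_left_less[OF continuous_on_const s_cont_on t1, of x1] x1 \<open>t0 > 0\<close> by auto
  have "\<sigma> * (wt t1 x1 - wt t1 y1) \<ge> 0"
  proof (rule derivative_nonneg_at_right_max[OF _ e(1)])
    show "((\<lambda>\<tau>. f \<tau> x1 y1) has_real_derivative \<sigma> * (wt t1 x1 - wt t1 y1)) (at t1)"
      unfolding f_def[abs_def] using t1pos x1 y1
      by (auto intro!: derivative_eq_intros w_t simp: algebra_simps)
    show "f \<tau> x1 y1 \<le> f t1 x1 y1" if "t1 - e < \<tau>" "\<tau> < t1" for \<tau>
      using e(2)[of \<tau>] that t1 p by (intro max) auto
  qed
  moreover have "M * Q < D * B" using B D_pos by (simp add: field_simps)
  moreover have "\<bar>\<sigma> * (w t1 x1 * q t1 x1)\<bar> \<le> M * Q" "\<bar>\<sigma> * (w t1 y1 * q t1 y1)\<bar> \<le> M * Q"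
    using \<sigma> reaction_bound[of t1 x1] reaction_bound[of t1 y1] t1pos x1 y1 by auto
  moreover have "D * B > 0" using D_pos B0 by simp
  ultimately show False using pde[OF t1pos x1(1)] pde[OF t1pos y1(1)] by (simp add: algebra_simps abs_le_iff)
qed

lemma uniformly_lipschitz:
  assumes "t0 > 0"
  shows "\<exists>L>0. \<forall>t\<ge>t0. \<forall>x\<in>{0..s t}. \<forall>y\<in>{0..s t}. \<bar>x - y\<bar> \<le> 1 \<longrightarrow> \<bar>w t x - w t y\<bar> \<le> L * \<bar>x - y\<bar>"
proof -
  have "continuous_on {0..s t0} (\<lambda>x. (\<lambda>(t, x). wx t x) (t0, x))"
    by (rule continuous_on_compose2[OF wx_cont]) (use assms in \<open>auto intro!: continuous_intros\<close>)
  then have "compact (wx t0 ` {0..s t0})" by (intro compact_continuous_image) simp_all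
  then have "bounded (wx t0 ` {0..s t0})" by (rule compact_imp_bounded)
  then obtain L0 where L0: "\<And>x. x \<in> {0..s t0} \<Longrightarrow> norm (wx t0 x) \<le> L0"
    unfolding bounded_iff by blast
  have init: "\<bar>w t0 x - w t0 y\<bar> \<le> L0 * \<bar>x - y\<bar>" if "x \<in> {0..s t0}" "y \<in> {0..s t0}" for x y
    using field_differentiable_bound[of "{0..s t0}" "w t0" "wx t0" L0 x y] w_x[OF assms] L0 that by simp
  define B where "B = M * Q / D + 1"
  define A where "A = max L0 (M + 1 + B) + B"
  have "M * Q / D \<ge> 0" using M_nonneg Q_nonneg D_pos by simp
  then have B: "B > M * Q / D" "B > 0" by (auto simp: B_def)
  have A: "A \<ge> M + B" "A > 2 * B" "A - B \<ge> L0" "A > 0" using M_nonneg B by (auto simp: A_def)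
  have init': "\<bar>w t0 x - w t0 y\<bar> \<le> (A - B) * \<bar>x - y\<bar>" if "x \<in> {0..s t0}" "y \<in> {0..s t0}" for x y
    using init[OF that] mult_right_mono[OF A(3), of "\<bar>x - y\<bar>"] by simp
  have lip: "\<bar>w t x - w t y\<bar> \<le> A * (x - y)" if "t \<ge> t0" "x \<le> s t" "0 \<le> y" "y \<le> x" "x - y \<le> 1" for t x y
  proof -
    have "\<sigma> * (w t x - w t y) \<le> A * (x - y)" if "\<sigma> = 1 \<or> \<sigma> = -1" for \<sigma>
    proof -
      have "\<sigma> * (w t x - w t y) \<le> A * (x - y) - B * (x - y)\<^sup>2"
        by (rule doubling[OF B(1) A(1,2) assms init' that]) (use \<open>t \<ge> t0\<close> \<open>x \<le> s t\<close> \<open>0 \<le> y\<close> \<open>y \<le> x\<close> \<open>x - y \<le> 1\<close> in auto)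
      then show ?thesis using B by (smt (verit) mult_nonneg_nonneg zero_le_power2)
    qed
    from this[of 1] this[of "-1"] show ?thesis by auto
  qed
  show ?thesis
  proof (intro exI[of _ A] conjI allI ballI impI)
    fix t x y assume *: "t0 \<le> t" "x \<in> {0..s t}" "y \<in> {0..s t}" "\<bar>x - y\<bar> \<le> 1"
    show "\<bar>w t x - w t y\<bar> \<le> A * \<bar>x - y\<bar>"
    proof (cases "y \<le> x")
      case True then show ?thesis using lip[of t x y] * by auto
    next
      case False then show ?thesis using lip[of t y x] * by (auto simp: abs_minus_commute)
    qed
  qed (use A in auto)
qed

end

section \<open>Moving subsolutions and vanishing\<close>

lemma moving_bump_constants:
  fixes D K V R :: real
  assumes "D > 0" "K \<ge> 0" "V \<ge> 0" "R > 0"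
  shows "\<exists>\<gamma> \<alpha>. \<gamma> > 0 \<and> \<alpha> \<ge> 0 \<and> (\<forall>y v. \<bar>y\<bar> \<le> R \<longrightarrow> \<bar>v\<bar> \<le> V \<longrightarrow>
    (K - \<alpha>) * (exp (- \<gamma> * y\<^sup>2) - exp (- \<gamma> * R\<^sup>2))
      + (2 * \<gamma> * y * v - D * (4 * \<gamma>\<^sup>2 * y\<^sup>2 - 2 * \<gamma>)) * exp (- \<gamma> * y\<^sup>2) \<le> 0)"
proof -
  define \<gamma> where "\<gamma> = 2 * (R * V + D) / (D * R\<^sup>2)"
  define c where "c = exp (- \<gamma> * (R/2)\<^sup>2) - exp (- \<gamma> * R\<^sup>2)"
  define \<alpha> where "\<alpha> = K + (2 * \<gamma> * R * V + 2 * D * \<gamma>) / c"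
  have RV: "R * V \<ge> 0" using assms by simp
  have \<gamma>: "\<gamma> > 0" using assms RV by (auto simp: \<gamma>_def intro!: divide_pos_pos add_nonneg_pos)
  have \<gamma>_eq: "D * \<gamma> * R\<^sup>2 = 2 * (R * V + D)" using assms by (simp add: \<gamma>_def)
  have "\<gamma> * (R/2)\<^sup>2 < \<gamma> * R\<^sup>2" using assms \<gamma> by (auto simp: power2_eq_square)
  then have c: "c > 0" by (simp add: c_def)
  have \<alpha>K: "(\<alpha> - K) * c = 2 * \<gamma> * R * V + 2 * D * \<gamma>" using c by (simp add: \<alpha>_def)
  have num: "2 * \<gamma> * R * V + 2 * D * \<gamma> \<ge> 0" using assms \<gamma> by simp
  have \<alpha>: "\<alpha> \<ge> K" using num c by (simp add: \<alpha>_def)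
  show ?thesis
  proof (rule exI[of _ \<gamma>], rule exI[of _ \<alpha>], intro conjI allI impI)
    fix y v :: real assume y: "\<bar>y\<bar> \<le> R" and v: "\<bar>v\<bar> \<le> V"
    define E where "E = exp (- \<gamma> * y\<^sup>2)"
    have "y\<^sup>2 \<le> R\<^sup>2" using y assms by (simp add: abs_le_square_iff[symmetric])
    then have \<phi>: "E - exp (- \<gamma> * R\<^sup>2) \<ge> 0" using \<gamma> by (simp add: E_def)
    have "y * v \<le> \<bar>y\<bar> * \<bar>v\<bar>" by (metis abs_ge_self abs_mult)
    also have "\<dots> \<le> R * V" using y v assms by (intro mult_mono) auto
    finally have yv: "y * v \<le> R * V" .
    have E: "0 < E" "E \<le> 1" using \<gamma> by (auto simp: E_def)
    show "(K - \<alpha>) * (exp (- \<gamma> * y\<^sup>2) - exp (- \<gamma> * R\<^sup>2))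
      + (2 * \<gamma> * y * v - D * (4 * \<gamma>\<^sup>2 * y\<^sup>2 - 2 * \<gamma>)) * exp (- \<gamma> * y\<^sup>2) \<le> 0"
    proof (cases "\<bar>y\<bar> \<le> R / 2")
      case True
      have "y\<^sup>2 \<le> (R/2)\<^sup>2" using True assms by (simp add: abs_le_square_iff[symmetric])
      then have "c \<le> E - exp (- \<gamma> * R\<^sup>2)" using \<gamma> by (simp add: E_def c_def)
      then have 1: "(\<alpha> - K) * c \<le> (\<alpha> - K) * (E - exp (- \<gamma> * R\<^sup>2))"
        using \<alpha> by (intro mult_left_mono) auto
      have "2 * \<gamma> * y * v \<le> 2 * \<gamma> * R * V" using yv \<gamma> by (simp add: mult.assoc)
      moreover have "D * (4 * \<gamma>\<^sup>2 * y\<^sup>2) \<ge> 0" using assms by simp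
      ultimately have "2 * \<gamma> * y * v - D * (4 * \<gamma>\<^sup>2 * y\<^sup>2 - 2 * \<gamma>) \<le> 2 * \<gamma> * R * V + 2 * D * \<gamma>"
        by (simp add: algebra_simps)
      then have "(2 * \<gamma> * y * v - D * (4 * \<gamma>\<^sup>2 * y\<^sup>2 - 2 * \<gamma>)) * E \<le> (2 * \<gamma> * R * V + 2 * D * \<gamma>) * E"
        using E by (intro mult_right_mono) auto
      also have "\<dots> \<le> 2 * \<gamma> * R * V + 2 * D * \<gamma>" using num E by (intro mult_left_le) auto
      finally show ?thesis using 1 \<alpha>K unfolding E_def[symmetric] by (simp add: algebra_simps)
    next
      case False
      have "(R/2)\<^sup>2 \<le> y\<^sup>2" using False assms by (simp add: abs_le_square_iff[symmetric])
      then have "D * \<gamma> * (R/2)\<^sup>2 \<le> D * \<gamma> * y\<^sup>2" using assms \<gamma> by (intro mult_left_mono) auto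
      then have "R * V + D \<le> 2 * (D * \<gamma> * y\<^sup>2)" using \<gamma>_eq by (simp add: power_divide)
      then have "y * v + D - 2 * (D * \<gamma> * y\<^sup>2) \<le> 0" using yv by linarith
      then have "2 * \<gamma> * (y * v + D - 2 * (D * \<gamma> * y\<^sup>2)) \<le> 0" using \<gamma> by (simp add: mult_le_0_iff)
      then have "2 * \<gamma> * y * v - D * (4 * \<gamma>\<^sup>2 * y\<^sup>2 - 2 * \<gamma>) \<le> 0"
        by (simp add: algebra_simps power2_eq_square)
      then have "(2 * \<gamma> * y * v - D * (4 * \<gamma>\<^sup>2 * y\<^sup>2 - 2 * \<gamma>)) * E \<le> 0"
        using E by (intro mult_nonpos_nonneg) auto
      moreover have "(K - \<alpha>) * (E - exp (- \<gamma> * R\<^sup>2)) \<le> 0" using \<alpha> \<phi> by (intro mult_nonpos_nonneg) auto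
      ultimately show ?thesis unfolding E_def[symmetric] by simp
    qed
  qed (use \<gamma> \<alpha> assms in auto)
qed

context bounded_free_boundary begin

lemma moving_bump:
  assumes R: "R > 0" and \<gamma>: "\<gamma> > 0"
    and sub: "\<And>y v. \<bar>y\<bar> \<le> R \<Longrightarrow> \<bar>v\<bar> \<le> V \<Longrightarrow>
      (Q - \<alpha>) * (exp (- \<gamma> * y\<^sup>2) - exp (- \<gamma> * R\<^sup>2))
        + (2 * \<gamma> * y * v - D * (4 * \<gamma>\<^sup>2 * y\<^sup>2 - 2 * \<gamma>)) * exp (- \<gamma> * y\<^sup>2) \<le> 0"
    and t0: "t0 \<ge> 0" and m: "m \<ge> 0"
    and \<xi>_cont: "continuous_on {t0..T} \<xi>"
    and \<xi>': "\<And>t. t \<in> {t0<..T} \<Longrightarrow> (\<xi> has_real_derivative \<xi>' t) (at t)"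
    and speed: "\<And>t. t \<in> {t0<..T} \<Longrightarrow> \<bar>\<xi>' t\<bar> \<le> V"
    and \<xi>: "\<And>t. t \<in> {t0..T} \<Longrightarrow> 0 \<le> \<xi> t" "\<And>t. t \<in> {t0..T} \<Longrightarrow> \<xi> t + R \<le> s t"
    and init: "\<And>x. x \<ge> 0 \<Longrightarrow> \<bar>x - \<xi> t0\<bar> \<le> R \<Longrightarrow> m \<le> w t0 x"
    and t: "t \<in> {t0..T}" and x: "x \<ge> 0" "\<bar>x - \<xi> t\<bar> \<le> R"
  shows "m * exp (- \<alpha> * (t - t0)) * (exp (- \<gamma> * (x - \<xi> t)\<^sup>2) - exp (- \<gamma> * R\<^sup>2)) \<le> w t x"
proof -
  define e where "e t = m * exp (- \<alpha> * (t - t0))" for t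
  define E where "E y = exp (- \<gamma> * y\<^sup>2)" for y
  define z where "z t x = e t * (E (x - \<xi> t) - E R) - w t x" for t x
  have e': "(e has_real_derivative - \<alpha> * e t) (at t)" for t
    unfolding e_def by (auto intro!: derivative_eq_intros)
  have E': "((\<lambda>x. E (f x)) has_real_derivative - 2 * \<gamma> * f x * E (f x) * f') (at x within S)"
    if "(f has_real_derivative f') (at x within S)" for f f' x S
    unfolding E_def using that by (auto intro!: derivative_eq_intros)
  have e0: "e t \<ge> 0" for t using m by (simp add: e_def)
  have E0: "E y > 0" for y by (simp add: E_def)
  have "z t x \<le> 0"
  proof (rule parabolic_comparison[where z = z and l = "\<lambda>t. max 0 (\<xi> t - R)" and r = "\<lambda>t. \<xi> t + R"
        and zt = "\<lambda>t x. - \<alpha> * e t * (E (x - \<xi> t) - E R) + e t * (2 * \<gamma> * (x - \<xi> t) * \<xi>' t * E (x - \<xi> t)) - wt t x"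
        and zx = "\<lambda>t x. e t * (- 2 * \<gamma> * (x - \<xi> t) * E (x - \<xi> t)) - wx t x"
        and zxx = "\<lambda>t x. e t * ((4 * \<gamma>\<^sup>2 * (x - \<xi> t)\<^sup>2 - 2 * \<gamma>) * E (x - \<xi> t)) - wxx t x"
        and ?t0.0 = t0 and T = T and C = 0])
    show "D \<ge> 0" using D_pos by simp
    show "continuous_on {t0..T} (\<lambda>t. max 0 (\<xi> t - R))" "continuous_on {t0..T} (\<lambda>t. \<xi> t + R)"
      by (intro continuous_intros \<xi>_cont)+
    show "max 0 (\<xi> \<tau> - R) < \<xi> \<tau> + R" if "\<tau> \<in> {t0..T}" for \<tau> using \<xi>(1)[OF that] R by auto
    show "continuous_on {(\<tau>, x). \<tau> \<in> {t0..T} \<and> x \<in> {max 0 (\<xi> \<tau> - R)..\<xi> \<tau> + R}} (\<lambda>(t, x). z t x)"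
      unfolding case_prod_unfold z_def e_def E_def using t0
      by (intro continuous_intros w_cont_on continuous_on_compose2[OF \<xi>_cont]) auto
    show "z t0 x \<le> 0" if "x \<in> {max 0 (\<xi> t0 - R)..\<xi> t0 + R}" for x
    proof -
      have "E (x - \<xi> t0) \<le> 1" using \<gamma> by (simp add: E_def)
      then have "E (x - \<xi> t0) - E R \<le> 1" using E0[of R] by linarith
      then have "m * (E (x - \<xi> t0) - E R) \<le> m * 1" using m by (intro mult_left_mono)
      moreover have "m \<le> w t0 x" using that by (intro init) auto
      ultimately show ?thesis by (simp add: z_def e_def)
    qed
    show "z \<tau> (\<xi> \<tau> + R) \<le> 0" if "\<tau> \<in> {t0<..T}" for \<tau>
      using w_nonneg[of \<tau> "\<xi> \<tau> + R"] \<xi>(1)[of \<tau>] that t0 R by (simp add: z_def)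
    show "z \<tau> (max 0 (\<xi> \<tau> - R)) \<le> 0 \<or>
      (\<exists>e\<ge>0. (z \<tau> has_real_derivative e) (at (max 0 (\<xi> \<tau> - R)) within {max 0 (\<xi> \<tau> - R)..\<xi> \<tau> + R}))"
      if "\<tau> \<in> {t0<..T}" for \<tau>
    proof (cases "\<xi> \<tau> \<ge> R")
      case True
      have "E (- R) = E R" by (simp add: E_def)
      then show ?thesis using True w_nonneg[of \<tau> "\<xi> \<tau> - R"] that t0 by (simp add: z_def)
    next
      case False
      have pos: "\<tau> > 0" "\<tau> \<in> {t0..T}" using that t0 by auto
      have "(z \<tau> has_real_derivative e \<tau> * (- 2 * \<gamma> * (0 - \<xi> \<tau>) * E (0 - \<xi> \<tau>) * 1) - wx \<tau> 0) (at 0 within {0..s \<tau>})"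
        unfolding z_def[abs_def] using pos s_pos[of \<tau>]
        by (auto intro!: derivative_eq_intros E' w_x)
      then have "(z \<tau> has_real_derivative e \<tau> * (2 * \<gamma> * \<xi> \<tau> * E (- \<xi> \<tau>))) (at 0 within {0..\<xi> \<tau> + R})"
        using neumann[OF pos(1)] \<xi>(2)[OF pos(2)] by (auto intro: DERIV_subset)
      moreover have "e \<tau> * (2 * \<gamma> * \<xi> \<tau> * E (- \<xi> \<tau>)) \<ge> 0"
        using e0[of \<tau>] E0[of "- \<xi> \<tau>"] \<gamma> \<xi>(1)[OF pos(2)] by (intro mult_nonneg_nonneg) auto
      ultimately show ?thesis using False by auto
    qed
    fix \<tau> y assume \<tau>: "\<tau> \<in> {t0<..T}" and y: "y \<in> {max 0 (\<xi> \<tau> - R)<..<\<xi> \<tau> + R}"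
    have in': "\<tau> > 0" "y \<in> {0<..<s \<tau>}" using \<tau> y t0 \<xi>(2)[of \<tau>] by auto
    show "((\<lambda>\<tau>. z \<tau> y) has_real_derivative
        - \<alpha> * e \<tau> * (E (y - \<xi> \<tau>) - E R) + e \<tau> * (2 * \<gamma> * (y - \<xi> \<tau>) * \<xi>' \<tau> * E (y - \<xi> \<tau>)) - wt \<tau> y) (at \<tau>)"
      unfolding z_def[abs_def]
      by (auto intro!: derivative_eq_intros e' E' \<xi>'[OF \<tau>] w_t[OF in'] simp: algebra_simps)
    show "(z \<tau> has_real_derivative e \<tau> * (- 2 * \<gamma> * (y - \<xi> \<tau>) * E (y - \<xi> \<tau>)) - wx \<tau> y) (at y)"
      unfolding z_def[abs_def]
      by (auto intro!: derivative_eq_intros E' w_x_interior[OF in'] simp: algebra_simps)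
    show "((\<lambda>y. e \<tau> * (- 2 * \<gamma> * (y - \<xi> \<tau>) * E (y - \<xi> \<tau>)) - wx \<tau> y) has_real_derivative
        e \<tau> * ((4 * \<gamma>\<^sup>2 * (y - \<xi> \<tau>)\<^sup>2 - 2 * \<gamma>) * E (y - \<xi> \<tau>)) - wxx \<tau> y) (at y)"
      by (auto intro!: derivative_eq_intros E' w_xx[OF in'] simp: algebra_simps power2_eq_square)
    assume z: "z \<tau> y > 0"
    define Y where "Y = y - \<xi> \<tau>"
    have "(Q - \<alpha>) * (E Y - E R) + (2 * \<gamma> * Y * \<xi>' \<tau> - D * (4 * \<gamma>\<^sup>2 * Y\<^sup>2 - 2 * \<gamma>)) * E Y \<le> 0"
      unfolding E_def using speed[OF \<tau>] y by (intro sub) (auto simp: Y_def)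
    then have 1: "e \<tau> * ((Q - \<alpha>) * (E Y - E R) + (2 * \<gamma> * Y * \<xi>' \<tau> - D * (4 * \<gamma>\<^sup>2 * Y\<^sup>2 - 2 * \<gamma>)) * E Y) \<le> 0"
      using e0[of \<tau>] by (intro mult_nonneg_nonpos)
    have "w \<tau> y * - q \<tau> y \<le> w \<tau> y * Q"
      using q_le[of \<tau> y] w_nonneg[of \<tau> y] in' by (intro mult_left_mono) auto
    also have "\<dots> \<le> e \<tau> * (E Y - E R) * Q"
      using z Q_nonneg by (intro mult_right_mono) (auto simp: z_def Y_def)
    finally show "- \<alpha> * e \<tau> * (E (y - \<xi> \<tau>) - E R) + e \<tau> * (2 * \<gamma> * (y - \<xi> \<tau>) * \<xi>' \<tau> * E (y - \<xi> \<tau>)) - wt \<tau> y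
      \<le> D * (e \<tau> * ((4 * \<gamma>\<^sup>2 * (y - \<xi> \<tau>)\<^sup>2 - 2 * \<gamma>) * E (y - \<xi> \<tau>)) - wxx \<tau> y) + 0 * z \<tau> y"
      using 1 pde[OF in'] unfolding Y_def[symmetric] by (simp add: algebra_simps)
  qed (use t x in auto)
  then show ?thesis by (simp add: z_def e_def E_def)
qed

lemma wx_boundary_lower_bound:
  assumes "t > 0" and lip: "\<And>x. x \<in> {0..s t} \<Longrightarrow> s t - x \<le> 1 \<Longrightarrow> w t x \<le> L * (s t - x)"
  shows "- L \<le> wx t (s t)"
proof -
  have "- L - wx t (s t) \<le> 0"
  proof (rule derivative_nonpos_at_right_min[where f = "\<lambda>x. L * (s t - x) - w t x" and a = 0 and b = "s t"
        and c = "max 0 (s t - 1)"])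
    show "((\<lambda>x. L * (s t - x) - w t x) has_real_derivative - L - wx t (s t)) (at (s t) within {0..s t})"
      using assms s_pos[of t] by (auto intro!: derivative_eq_intros w_x)
    show "L * (s t - s t) - w t (s t) \<le> L * (s t - y) - w t y" if "y \<in> {max 0 (s t - 1)..s t}" for y
      using lip[of y] w_zero[of t "s t"] that \<open>t > 0\<close> by auto
  qed (use s_pos[of t] \<open>t > 0\<close> in auto)
  then show ?thesis by simp
qed

lemma vanishing:
  assumes lim: "(s \<longlongrightarrow> S) at_top" and "\<epsilon> > 0"
  shows "\<exists>T\<ge>0. \<forall>t\<ge>T. \<forall>x\<ge>0. w t x \<le> \<epsilon>"
proof (rule ccontr)
  assume "\<not> ?thesis"
  then have big: "\<exists>t\<ge>T. \<exists>x\<ge>0. w t x > \<epsilon>" if "T \<ge> 0" for T using that by (meson not_le)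
  obtain L where L: "L > 0" and lip: "\<And>t x y. t \<ge> 1 \<Longrightarrow> x \<in> {0..s t} \<Longrightarrow> y \<in> {0..s t} \<Longrightarrow> \<bar>x - y\<bar> \<le> 1 \<Longrightarrow>
      \<bar>w t x - w t y\<bar> \<le> L * \<bar>x - y\<bar>"
    using uniformly_lipschitz[of 1] by auto
  have s_le: "s t \<le> S" if "t \<ge> 0" for t
  proof (rule tendsto_lowerbound[OF lim])
    show "\<forall>\<^sub>F \<tau> in at_top. s t \<le> s \<tau>"
      using eventually_ge_at_top[of t] by eventually_elim (use that s_mono in auto)
  qed auto
  have S0: "S > 0" using s_le[of 0] s_pos[of 0] by simp
  define R where "R = min (\<epsilon> / (4 * L)) (1/2)"
  have R: "R > 0" "2 * R \<le> 1" using \<open>\<epsilon> > 0\<close> L by (auto simp: R_def)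
  have "R \<le> \<epsilon> / (4 * L)" by (simp add: R_def)
  then have RL: "4 * (L * R) \<le> \<epsilon>" using L by (simp add: field_simps)
  define V where "V = k * L + S"
  have "V \<ge> 0" using k_pos L S0 by (simp add: V_def)
  then obtain \<gamma> \<alpha> where \<gamma>: "\<gamma> > 0" and \<alpha>: "\<alpha> \<ge> 0" and sub: "\<And>y v. \<bar>y\<bar> \<le> R \<Longrightarrow> \<bar>v\<bar> \<le> V \<Longrightarrow>
      (Q - \<alpha>) * (exp (- \<gamma> * y\<^sup>2) - exp (- \<gamma> * R\<^sup>2))
        + (2 * \<gamma> * y * v - D * (4 * \<gamma>\<^sup>2 * y\<^sup>2 - 2 * \<gamma>)) * exp (- \<gamma> * y\<^sup>2) \<le> 0"
    using moving_bump_constants[OF D_pos Q_nonneg _ R(1), of V] by blast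
  define \<delta> where "\<delta> = \<epsilon> / 2 * exp (- \<alpha> * 2) * (2 * \<gamma> * R * exp (- \<gamma> * R\<^sup>2))"
  have \<delta>: "\<delta> > 0" using \<open>\<epsilon> > 0\<close> \<gamma> R by (simp add: \<delta>_def)
  have fast: "wx t1 (s t1) \<le> - \<delta>"
    if t: "t \<ge> 1" and x: "x \<ge> 0" and wt: "w t x > \<epsilon>" and t1: "t + 1 \<le> t1" "t1 \<le> t + 2" for t x t1
  proof -
    have t0: "t \<ge> 0" using t by simp
    have xs: "x < s t" using w_zero[of t x] wt t0 \<open>\<epsilon> > 0\<close> by (cases "x < s t") auto
    have gap: "s t - x > 2 * R"
    proof (cases "s t - x \<le> 1")
      case True
      have "\<bar>w t x - w t (s t)\<bar> \<le> L * \<bar>x - s t\<bar>" using lip[of t x "s t"] t x xs True by auto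
      then have "4 * (L * R) < L * (s t - x)" using w_zero[of t "s t"] t0 wt xs RL by simp
      then have "L * (4 * R) < L * (s t - x)" by (simp add: algebra_simps)
      then have "4 * R < s t - x" using L by simp
      then show ?thesis using R by linarith
    qed (use R in auto)
    define c where "c = s t - x - 2 * R"
    have c: "0 \<le> c" "c \<le> S" using gap s_le[OF t0] x R by (auto simp: c_def)
    \<comment> \<open>The right edge of the bump starts at \<open>x + 2 * R\<close> at time \<open>t\<close> and meets the free boundary
      exactly at time \<open>t1\<close>.\<close>
    define \<xi> where "\<xi> \<tau> = s \<tau> - R - c * (1 - (\<tau> - t) / (t1 - t))" for \<tau>
    have bump: "\<epsilon> / 2 * exp (- \<alpha> * (t1 - t)) * (exp (- \<gamma> * (y - \<xi> t1)\<^sup>2) - exp (- \<gamma> * R\<^sup>2)) \<le> w t1 y"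
      if y: "y \<ge> 0" "\<bar>y - \<xi> t1\<bar> \<le> R" for y
    proof (rule moving_bump[OF R(1) \<gamma> sub t0, where T = t1 and \<xi>' = "\<lambda>\<tau>. - k * wx \<tau> (s \<tau>) + c / (t1 - t)"])
      show "continuous_on {t..t1} \<xi>"
        unfolding \<xi>_def using t0 t1 by (intro continuous_intros s_cont_on) auto
      fix \<tau> assume \<tau>: "\<tau> \<in> {t<..t1}"
      then show "(\<xi> has_real_derivative - k * wx \<tau> (s \<tau>) + c / (t1 - t)) (at \<tau>)"
        unfolding \<xi>_def[abs_def] using t0 t1 by (auto intro!: derivative_eq_intros stefan)
      have "- L \<le> wx \<tau> (s \<tau>)"
      proof (rule wx_boundary_lower_bound)
        show "w \<tau> x \<le> L * (s \<tau> - x)" if "x \<in> {0..s \<tau>}" "s \<tau> - x \<le> 1" for x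
          using lip[of \<tau> x "s \<tau>"] that \<tau> t s_pos[of \<tau>] w_zero[of \<tau> "s \<tau>"] by auto
      qed (use \<tau> t in auto)
      then have "k * - wx \<tau> (s \<tau>) \<le> k * L" using k_pos by (intro mult_left_mono) auto
      moreover have "- k * wx \<tau> (s \<tau>) \<ge> 0" using speed_nonneg \<tau> t by simp
      moreover have "0 \<le> c / (t1 - t)" using c t1 by simp
      moreover have "c / (t1 - t) \<le> c / 1" using c t1 by (intro divide_left_mono) auto
      ultimately show "\<bar>- k * wx \<tau> (s \<tau>) + c / (t1 - t)\<bar> \<le> V" using c by (simp add: V_def)
    next
      fix \<tau> assume \<tau>: "\<tau> \<in> {t..t1}"
      have frac: "0 \<le> 1 - (\<tau> - t) / (t1 - t)" "1 - (\<tau> - t) / (t1 - t) \<le> 1" using \<tau> t1 by auto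
      have "c * (1 - (\<tau> - t) / (t1 - t)) \<le> c" using c frac by (intro mult_left_le) auto
      then show "0 \<le> \<xi> \<tau>" using s_mono[of t \<tau>] \<tau> t0 x R by (simp add: \<xi>_def c_def)
      show "\<xi> \<tau> + R \<le> s \<tau>" using c frac by (simp add: \<xi>_def)
    next
      fix y assume "y \<ge> 0" "\<bar>y - \<xi> t\<bar> \<le> R"
      then have y: "x \<le> y" "y \<le> x + 2 * R" by (auto simp: \<xi>_def c_def)
      then have "\<bar>w t x - w t y\<bar> \<le> L * \<bar>x - y\<bar>" using t x gap R by (intro lip) auto
      moreover have "L * \<bar>x - y\<bar> \<le> L * (2 * R)" using y L by (intro mult_left_mono) auto
      ultimately show "\<epsilon> / 2 \<le> w t y" using RL wt by (simp add: algebra_simps)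
    qed (use \<open>\<epsilon> > 0\<close> t1 y in auto)
    have t1pos: "t1 > 0" using t t1 by simp
    have \<xi>1: "\<xi> t1 = s t1 - R" using t1 by (simp add: \<xi>_def)
    define m where "m = \<epsilon> / 2 * exp (- \<alpha> * (t1 - t))"
    have "wx t1 (s t1) - m * (- (2 * \<gamma> * R * exp (- \<gamma> * R\<^sup>2))) \<le> 0"
    proof (rule derivative_nonpos_at_right_min[where a = 0 and b = "s t1" and c = "max 0 (s t1 - 2 * R)"
          and f = "\<lambda>y. w t1 y - m * (exp (- \<gamma> * (y - (s t1 - R))\<^sup>2) - exp (- \<gamma> * R\<^sup>2))"])
      show "((\<lambda>y. w t1 y - m * (exp (- \<gamma> * (y - (s t1 - R))\<^sup>2) - exp (- \<gamma> * R\<^sup>2))) has_real_derivative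
          wx t1 (s t1) - m * (- (2 * \<gamma> * R * exp (- \<gamma> * R\<^sup>2)))) (at (s t1) within {0..s t1})"
        using t1pos s_pos[of t1] by (auto intro!: derivative_eq_intros w_x)
      show "w t1 (s t1) - m * (exp (- \<gamma> * (s t1 - (s t1 - R))\<^sup>2) - exp (- \<gamma> * R\<^sup>2))
          \<le> w t1 y - m * (exp (- \<gamma> * (y - (s t1 - R))\<^sup>2) - exp (- \<gamma> * R\<^sup>2))"
        if "y \<in> {max 0 (s t1 - 2 * R)..s t1}" for y
        using bump[of y] that w_zero[of t1 "s t1"] t1pos unfolding \<xi>1 m_def by (auto simp: abs_le_iff)
    qed (use R s_pos[of t1] t1pos in auto)
    moreover have "\<delta> \<le> m * (2 * \<gamma> * R * exp (- \<gamma> * R\<^sup>2))"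
    proof -
      have "\<alpha> * (t1 - t) \<le> \<alpha> * 2" using \<alpha> t1 by (intro mult_left_mono) auto
      then show ?thesis unfolding \<delta>_def m_def using \<open>\<epsilon> > 0\<close> \<gamma> R
        by (intro mult_right_mono mult_left_mono) auto
    qed
    ultimately show ?thesis by simp
  qed
  have "k * \<delta> > 0" using k_pos \<delta> by simp
  then have "\<forall>\<^sub>F t in at_top. s t > S - k * \<delta>" by (intro order_tendstoD[OF lim]) auto
  then obtain T where T: "\<And>t. t \<ge> T \<Longrightarrow> s t > S - k * \<delta>" by (auto simp: eventually_at_top_linorder)
  obtain t x where tx: "t \<ge> max 1 T" "x \<ge> 0" "w t x > \<epsilon>" using big[of "max 1 T"] by (auto simp: le_max_iff_disj)
  have "\<exists>z>t + 1. z < t + 2 \<and> s (t + 2) - s (t + 1) = (t + 2 - (t + 1)) * (- k * wx z (s z))"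
    by (rule MVT2) (use tx stefan in auto)
  then obtain z where z: "z > t + 1" "z < t + 2" "s (t + 2) - s (t + 1) = k * - wx z (s z)" by auto
  have "k * \<delta> \<le> k * - wx z (s z)"
    using fast[of t x z] tx z k_pos by (intro mult_left_mono) auto
  then show False using z T[of "t + 1"] s_le[of "t + 2"] tx by auto
qed

end

section \<open>Spreading\<close>

lemma exp_decay_tendsto_0:
  fixes A t0 :: real
  assumes "A > 0"
  shows "((\<lambda>t. exp (- A * (t - t0))) \<longlongrightarrow> 0) at_top"
proof (rule filterlim_compose[OF exp_at_bot])
  have lim: "filterlim (\<lambda>t. t - t0) at_top at_top"
    using filterlim_tendsto_add_at_top[OF tendsto_const filterlim_ident, of "- t0"] by simp
  show "filterlim (\<lambda>t. - A * (t - t0)) at_bot at_top"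
    by (rule filterlim_tendsto_neg_mult_at_bot[OF tendsto_const _ lim]) (use assms in auto)
qed

context bounded_free_boundary begin

lemma positive:
  assumes t: "t \<ge> 0" and x: "x \<in> {0..<s t}"
  shows "w t x > 0"
proof (cases "t = 0")
  case True then show ?thesis using init_pos x by simp
next
  case False
  define t0 where "t0 = t / 2"
  have t0: "0 < t0" "t0 < t" using False t by (auto simp: t0_def)
  define \<sigma> where "\<sigma> = s 0"
  have \<sigma>: "\<sigma> > 0" using s_pos[of 0] by (simp add: \<sigma>_def)
  have s_ge: "s \<tau> \<ge> \<sigma>" if "\<tau> \<ge> 0" for \<tau> using s_mono[of 0 \<tau>] that by (simp add: \<sigma>_def)
  obtain m1 where m1: "m1 > 0" "\<And>y. \<bar>y - \<sigma> / 2\<bar> \<le> \<sigma> / 8 \<Longrightarrow> m1 \<le> w t0 y"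
  proof -
    obtain \<gamma> \<alpha> where \<gamma>: "\<gamma> > 0" and sub: "\<And>y v. \<bar>y\<bar> \<le> \<sigma> / 4 \<Longrightarrow> \<bar>v\<bar> \<le> 0 \<Longrightarrow>
      (Q - \<alpha>) * (exp (- \<gamma> * y\<^sup>2) - exp (- \<gamma> * (\<sigma> / 4)\<^sup>2))
        + (2 * \<gamma> * y * v - D * (4 * \<gamma>\<^sup>2 * y\<^sup>2 - 2 * \<gamma>)) * exp (- \<gamma> * y\<^sup>2) \<le> 0"
      using moving_bump_constants[OF D_pos Q_nonneg order_refl, of "\<sigma> / 4"] \<sigma> by auto
    have "continuous_on {\<sigma> / 4..3 * \<sigma> / 4} (w 0)" by (rule w_cont_comp) (use \<sigma> in \<open>auto intro!: continuous_intros\<close>)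
    then have "\<exists>y\<in>{\<sigma> / 4..3 * \<sigma> / 4}. \<forall>y'\<in>{\<sigma> / 4..3 * \<sigma> / 4}. w 0 y \<le> w 0 y'"
      using \<sigma> by (intro continuous_attains_inf) auto
    then obtain y0 where y0: "y0 \<in> {\<sigma> / 4..3 * \<sigma> / 4}" "\<And>y. y \<in> {\<sigma> / 4..3 * \<sigma> / 4} \<Longrightarrow> w 0 y0 \<le> w 0 y" by auto
    define m where "m = w 0 y0"
    have m: "m > 0" unfolding m_def using y0 \<sigma> by (intro init_pos) (auto simp: \<sigma>_def)
    define m1 where "m1 = m * exp (- \<alpha> * (t0 - 0)) * (exp (- \<gamma> * (\<sigma> / 8)\<^sup>2) - exp (- \<gamma> * (\<sigma> / 4)\<^sup>2))"
    show ?thesis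
    proof (rule that)
      have "\<gamma> * (\<sigma> / 8)\<^sup>2 < \<gamma> * (\<sigma> / 4)\<^sup>2" using \<gamma> \<sigma> by (simp add: power2_eq_square)
      then show "m1 > 0" using m by (simp add: m1_def)
      fix y assume y: "\<bar>y - \<sigma> / 2\<bar> \<le> \<sigma> / 8"
      have "m * exp (- \<alpha> * (t0 - 0)) * (exp (- \<gamma> * (y - \<sigma> / 2)\<^sup>2) - exp (- \<gamma> * (\<sigma> / 4)\<^sup>2)) \<le> w t0 y"
      proof (rule moving_bump[where V = 0 and \<xi> = "\<lambda>_. \<sigma> / 2" and \<xi>' = "\<lambda>_. 0" and T = t0, OF _ \<gamma> sub])
        show "m \<le> w 0 x" if "\<bar>x - \<sigma> / 2\<bar> \<le> \<sigma> / 4" for x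
        proof -
          have "\<sigma> / 4 \<le> x" "x \<le> 3 * \<sigma> / 4" using that by linarith+
          then show ?thesis unfolding m_def by (intro y0(2)) auto
        qed
        show "\<sigma> / 2 + \<sigma> / 4 \<le> s \<tau>" if "\<tau> \<in> {0..t0}" for \<tau> using s_ge[of \<tau>] that \<sigma> by auto
        show "0 \<le> y" "\<bar>y - \<sigma> / 2\<bar> \<le> \<sigma> / 4" using y \<sigma> by linarith+
      qed (use \<sigma> t0 m in auto)
      moreover have "m1 \<le> m * exp (- \<alpha> * (t0 - 0)) * (exp (- \<gamma> * (y - \<sigma> / 2)\<^sup>2) - exp (- \<gamma> * (\<sigma> / 4)\<^sup>2))"
      proof -
        have "(y - \<sigma> / 2)\<^sup>2 \<le> (\<sigma> / 8)\<^sup>2" using y \<sigma> by (simp add: abs_le_square_iff[symmetric])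
        then show ?thesis unfolding m1_def using m \<gamma> by (intro mult_left_mono diff_right_mono) auto
      qed
      ultimately show "m1 \<le> w t0 y" by simp
    qed
  qed
  define r0 where "r0 = \<sigma> / 2 / s t0"
  define r1 where "r1 = x / s t"
  have r0: "0 \<le> r0" "r0 < 1" using s_ge[of t0] t0 \<sigma> by (auto simp: r0_def)
  have r1: "0 \<le> r1" "r1 < 1" using x by (auto simp: r1_def)
  define r where "r \<tau> = r0 + (r1 - r0) * ((\<tau> - t0) / (t - t0))" for \<tau>
  have r: "0 \<le> r \<tau>" "r \<tau> \<le> max r0 r1" if "\<tau> \<in> {t0..t}" for \<tau>
  proof -
    define \<theta> where "\<theta> = (\<tau> - t0) / (t - t0)"
    have \<theta>: "0 \<le> \<theta>" "\<theta> \<le> 1" using that t0 by (auto simp: \<theta>_def)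
    have eq: "r \<tau> = (1 - \<theta>) * r0 + \<theta> * r1" by (simp add: r_def \<theta>_def[symmetric] algebra_simps)
    show "0 \<le> r \<tau>" unfolding eq using \<theta> r0 r1 by simp
    show "r \<tau> \<le> max r0 r1" unfolding eq using \<theta> by (intro convex_bound_le) auto
  qed
  define R where "R = min (\<sigma> / 8) (\<sigma> * (1 - max r0 r1))"
  have R: "R > 0" using \<sigma> r0 r1 by (auto simp: R_def)
  obtain L where L: "L > 0" and lip: "\<And>t x y. t \<ge> t0 \<Longrightarrow> x \<in> {0..s t} \<Longrightarrow> y \<in> {0..s t} \<Longrightarrow> \<bar>x - y\<bar> \<le> 1 \<Longrightarrow>
      \<bar>w t x - w t y\<bar> \<le> L * \<bar>x - y\<bar>"
    using uniformly_lipschitz[OF t0(1)] by auto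
  define V where "V = k * L + s t * (\<bar>r1 - r0\<bar> / (t - t0))"
  have "V \<ge> 0" using k_pos L t0 s_pos[of t] by (simp add: V_def)
  then obtain \<gamma> \<alpha> where \<gamma>: "\<gamma> > 0" and sub: "\<And>y v. \<bar>y\<bar> \<le> R \<Longrightarrow> \<bar>v\<bar> \<le> V \<Longrightarrow>
      (Q - \<alpha>) * (exp (- \<gamma> * y\<^sup>2) - exp (- \<gamma> * R\<^sup>2))
        + (2 * \<gamma> * y * v - D * (4 * \<gamma>\<^sup>2 * y\<^sup>2 - 2 * \<gamma>)) * exp (- \<gamma> * y\<^sup>2) \<le> 0"
    using moving_bump_constants[OF D_pos Q_nonneg _ R, of V] by blast
  define \<xi> where "\<xi> \<tau> = s \<tau> * r \<tau>" for \<tau>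
  have \<xi>t: "\<xi> t = x" "\<xi> t0 = \<sigma> / 2" using t0 s_pos[of t] s_pos[of t0] by (auto simp: \<xi>_def r_def r0_def r1_def)
  have "m1 * exp (- \<alpha> * (t - t0)) * (exp (- \<gamma> * (x - \<xi> t)\<^sup>2) - exp (- \<gamma> * R\<^sup>2)) \<le> w t x"
  proof (rule moving_bump[OF R \<gamma> sub, where T = t
        and \<xi>' = "\<lambda>\<tau>. - k * wx \<tau> (s \<tau>) * r \<tau> + s \<tau> * ((r1 - r0) / (t - t0))"])
    show "continuous_on {t0..t} \<xi>"
      unfolding \<xi>_def r_def using t0 by (intro continuous_intros s_cont_on) auto
    show "m1 \<le> w t0 y" if "\<bar>y - \<xi> t0\<bar> \<le> R" for y
      using that by (intro m1) (auto simp: \<xi>t R_def)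
    fix \<tau> assume \<tau>: "\<tau> \<in> {t0<..t}"
    have r': "(r has_real_derivative (r1 - r0) / (t - t0)) (at \<tau>)"
      unfolding r_def[abs_def] using t0 by (auto intro!: derivative_eq_intros)
    show "(\<xi> has_real_derivative - k * wx \<tau> (s \<tau>) * r \<tau> + s \<tau> * ((r1 - r0) / (t - t0))) (at \<tau>)"
      unfolding \<xi>_def[abs_def]
      by (rule DERIV_cong[OF DERIV_mult[OF stefan r']]) (use \<tau> t0 in auto)
    have "- L \<le> wx \<tau> (s \<tau>)"
    proof (rule wx_boundary_lower_bound)
      show "w \<tau> x \<le> L * (s \<tau> - x)" if "x \<in> {0..s \<tau>}" "s \<tau> - x \<le> 1" for x
        using lip[of \<tau> x "s \<tau>"] that \<tau> t0 s_pos[of \<tau>] w_zero[of \<tau> "s \<tau>"] by auto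
    qed (use \<tau> t0 in auto)
    then have "k * - wx \<tau> (s \<tau>) \<le> k * L" using k_pos by (intro mult_left_mono) auto
    moreover have s': "- k * wx \<tau> (s \<tau>) \<ge> 0" using speed_nonneg \<tau> t0 by simp
    moreover have r\<tau>: "0 \<le> r \<tau>" "r \<tau> \<le> 1" using r[of \<tau>] \<tau> r0 r1 by auto
    ultimately have "- k * wx \<tau> (s \<tau>) * r \<tau> \<le> k * L" "- k * wx \<tau> (s \<tau>) * r \<tau> \<ge> 0"
      using mult_left_le[of "r \<tau>" "- k * wx \<tau> (s \<tau>)"] mult_nonneg_nonneg[OF s' r\<tau>(1)] by auto
    moreover have "\<bar>s \<tau> * ((r1 - r0) / (t - t0))\<bar> \<le> s t * (\<bar>r1 - r0\<bar> / (t - t0))"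
      using s_mono[of \<tau> t] s_pos[of \<tau>] \<tau> t0 by (auto simp: abs_mult intro!: mult_right_mono divide_right_mono)
    ultimately show "\<bar>- k * wx \<tau> (s \<tau>) * r \<tau> + s \<tau> * ((r1 - r0) / (t - t0))\<bar> \<le> V"
      unfolding V_def by linarith
  next
    fix \<tau> assume \<tau>: "\<tau> \<in> {t0..t}"
    show "0 \<le> \<xi> \<tau>" using r(1)[OF \<tau>] s_pos[of \<tau>] \<tau> t0 by (simp add: \<xi>_def)
    have "R \<le> \<sigma> * (1 - max r0 r1)" by (simp add: R_def)
    also have "\<dots> \<le> s \<tau> * (1 - r \<tau>)"
      using r[OF \<tau>] s_ge[of \<tau>] \<sigma> r0 r1 \<tau> t0 by (intro mult_mono) auto
    finally show "\<xi> \<tau> + R \<le> s \<tau>" by (simp add: \<xi>_def algebra_simps)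
  qed (use R t0 m1 x \<xi>t in auto)
  moreover have "m1 * exp (- \<alpha> * (t - t0)) * (exp (- \<gamma> * (x - \<xi> t)\<^sup>2) - exp (- \<gamma> * R\<^sup>2)) > 0"
    using m1 R \<gamma> by (simp add: \<xi>t)
  ultimately show ?thesis by simp
qed

lemma eventually_le:
  assumes A: "A > 0" and T0: "T0 \<ge> 0"
    and q: "\<And>t x. t \<ge> T0 \<Longrightarrow> x \<ge> 0 \<Longrightarrow> q t x \<le> A - w t x" and "\<epsilon> > 0"
  shows "\<exists>T. \<forall>t\<ge>T. \<forall>x\<ge>0. w t x \<le> A + \<epsilon>"
proof -
  define P where "P t = M * exp (- A * (t - T0))" for t
  have P0: "P t \<ge> 0" for t using M_nonneg by (simp add: P_def)
  have le: "w t x \<le> A + P t" if "t \<ge> T0" "x \<ge> 0" for t x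
  proof (rule upper_bound[OF T0, where Y' = "\<lambda>t. - A * P t"])
    show "((\<lambda>t. A + P t) has_real_derivative - A * P \<tau>) (at \<tau>)" for \<tau>
      unfolding P_def[abs_def] by (auto intro!: derivative_eq_intros)
    show "w T0 x \<le> A + P T0" if "x \<ge> 0" for x using w_le[OF T0 that] A by (simp add: P_def)
    show "w \<tau> y * q \<tau> y \<le> - A * P \<tau>" if "\<tau> > T0" "y \<in> {0<..<s \<tau>}" "w \<tau> y > A + P \<tau>" for \<tau> y
    proof -
      have wA: "w \<tau> y > A" using that P0[of \<tau>] by linarith
      have "w \<tau> y * q \<tau> y \<le> w \<tau> y * (A - w \<tau> y)"
        using q[of \<tau> y] that T0 wA A by (intro mult_left_mono) auto
      also have "\<dots> \<le> A * (A - w \<tau> y)" using wA by (intro mult_right_mono_neg) auto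
      also have "\<dots> \<le> A * (- P \<tau>)" using that A by (intro mult_left_mono) auto
      finally show ?thesis by simp
    qed
  qed (use that P0 A in \<open>auto intro!: add_nonneg_nonneg\<close>)
  have "(P \<longlongrightarrow> 0) at_top" unfolding P_def[abs_def]
    using tendsto_mult_right_zero[OF exp_decay_tendsto_0[OF A]] .
  then have "\<forall>\<^sub>F t in at_top. P t < \<epsilon>" using \<open>\<epsilon> > 0\<close> by (intro order_tendstoD) auto
  then obtain T where T: "\<And>t. t \<ge> T \<Longrightarrow> P t < \<epsilon>" by (auto simp: eventually_at_top_linorder)
  show ?thesis
  proof (intro exI[of _ "max T T0"] allI impI)
    fix t x :: real assume "t \<ge> max T T0" "x \<ge> 0"
    then show "w t x \<le> A + \<epsilon>" using le[of t x] T[of t] by auto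
  qed
qed

lemma eventually_ge:
  assumes A: "A > 0" and T0: "T0 \<ge> 0" and s: "filterlim s at_top at_top"
    and q: "\<And>t x. t \<ge> T0 \<Longrightarrow> x \<ge> 0 \<Longrightarrow> q t x \<ge> A - w t x" and "\<epsilon> > 0" "X \<ge> 0"
  shows "\<exists>T. \<forall>t\<ge>T. \<forall>x\<in>{0..X}. w t x \<ge> A - \<epsilon>"
proof -
  have lim0: "((\<lambda>l::real. pi / (2 * l)) \<longlongrightarrow> 0) at_top"
    by (intro tendsto_divide_0[OF tendsto_const] filterlim_at_top_imp_at_infinity
        filterlim_tendsto_pos_mult_at_top[OF tendsto_const _ filterlim_ident]) auto
  have "((\<lambda>l. A - D * (pi / (2 * l))\<^sup>2) \<longlongrightarrow> A - D * 0\<^sup>2) at_top"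
    by (intro tendsto_diff tendsto_mult tendsto_power tendsto_const lim0)
  then have lim1: "((\<lambda>l. A - D * (pi / (2 * l))\<^sup>2) \<longlongrightarrow> A) at_top" by simp
  have lim2: "((\<lambda>l. (A - D * (pi / (2 * l))\<^sup>2) * cos (pi / (2 * l) * X)) \<longlongrightarrow> A * cos (0 * X)) at_top"
    by (intro tendsto_mult tendsto_cos tendsto_const lim1 lim0)
  have "\<forall>\<^sub>F l in at_top. l > X \<and> A - D * (pi / (2 * l))\<^sup>2 > 0 \<and>
      (A - D * (pi / (2 * l))\<^sup>2) * cos (pi / (2 * l) * X) > A - \<epsilon>"
    using order_tendstoD(1)[OF lim1, of 0] order_tendstoD(1)[OF lim2, of "A - \<epsilon>"] A \<open>\<epsilon> > 0\<close>
    by (intro eventually_conj eventually_gt_at_top) auto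
  then obtain l where l: "l > X" "A - D * (pi / (2 * l))\<^sup>2 > 0"
      "(A - D * (pi / (2 * l))\<^sup>2) * cos (pi / (2 * l) * X) > A - \<epsilon>"
    using eventually_happens'[OF trivial_limit_at_top_linorder] by blast
  define \<kappa> where "\<kappa> = pi / (2 * l)"
  define A' where "A' = A - D * \<kappa>\<^sup>2"
  have l0: "l > 0" using l \<open>X \<ge> 0\<close> by simp
  have \<kappa>: "\<kappa> > 0" "\<kappa> * l = pi / 2" using l0 by (auto simp: \<kappa>_def)
  have A': "A' > 0" "A' * cos (\<kappa> * X) > A - \<epsilon>" using l by (auto simp: A'_def \<kappa>_def)
  have range: "0 \<le> \<kappa> * x \<and> \<kappa> * x \<le> pi / 2" if "x \<in> {0..l}" for x
  proof -
    have "\<kappa> * x \<le> \<kappa> * l" using that \<kappa> by (intro mult_left_mono) auto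
    then show ?thesis using that \<kappa> by simp
  qed
  have cos0: "0 \<le> cos (\<kappa> * x)" if "x \<in> {0..l}" for x
    using range[OF that] by (intro cos_ge_zero) auto
  obtain T1 where T1: "T1 \<ge> T0" "\<And>t. t \<ge> T1 \<Longrightarrow> s t > l"
  proof -
    have "\<forall>\<^sub>F t in at_top. s t > l" using s by (auto simp: filterlim_at_top_dense)
    then obtain T where "\<And>t. t \<ge> T \<Longrightarrow> s t > l" by (auto simp: eventually_at_top_linorder)
    then show ?thesis using that[of "max T T0"] by auto
  qed
  obtain m0 where m0: "m0 > 0" "\<And>x. x \<in> {0..l} \<Longrightarrow> m0 \<le> w T1 x"
  proof -
    have "continuous_on {0..l} (w T1)"
      by (rule w_cont_comp) (use T1 T0 in \<open>auto intro!: continuous_intros\<close>)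
    then have "\<exists>y\<in>{0..l}. \<forall>y'\<in>{0..l}. w T1 y \<le> w T1 y'"
      using l0 by (intro continuous_attains_inf) auto
    then obtain y where y: "y \<in> {0..l}" "\<And>y'. y' \<in> {0..l} \<Longrightarrow> w T1 y \<le> w T1 y'" by auto
    have "w T1 y > 0" using y T1(2)[of T1] T1(1) T0 by (intro positive) auto
    then show ?thesis using that y by blast
  qed
  define m where "m = min m0 A'"
  have m: "m > 0" "m \<le> A'" "m \<le> m0" using m0 A' by (auto simp: m_def)
  define p where "p t = A' - (A' - m) * exp (- m * (t - T1))" for t
  have p': "(p has_real_derivative m * (A' - p t)) (at t)" for t
    unfolding p_def[abs_def] by (auto intro!: derivative_eq_intros simp: algebra_simps)
  have p: "m \<le> p t" "p t \<le> A'" if "t \<ge> T1" for t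
  proof -
    have "exp (- m * (t - T1)) \<le> 1" using that m by simp
    then have "(A' - m) * exp (- m * (t - T1)) \<le> A' - m" using m by (intro mult_left_le) auto
    then show "m \<le> p t" by (simp add: p_def)
    show "p t \<le> A'" using m by (simp add: p_def)
  qed
  have below: "p t * cos (\<kappa> * x) \<le> w t x" if t: "t \<ge> T1" and x: "x \<in> {0..l}" for t x
  proof -
    have "p t * cos (\<kappa> * x) - w t x \<le> 0"
    proof (rule parabolic_comparison[where z = "\<lambda>t x. p t * cos (\<kappa> * x) - w t x"
          and l = "\<lambda>_. 0" and r = "\<lambda>_. l" and zt = "\<lambda>t x. m * (A' - p t) * cos (\<kappa> * x) - wt t x"
          and zx = "\<lambda>t x. - (p t * \<kappa> * sin (\<kappa> * x)) - wx t x"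
          and zxx = "\<lambda>t x. - (p t * \<kappa>\<^sup>2 * cos (\<kappa> * x)) - wxx t x"
          and ?t0.0 = T1 and T = t and C = A])
      show "D \<ge> 0" using D_pos by simp
      show "continuous_on {(\<tau>, x). \<tau> \<in> {T1..t} \<and> x \<in> {0..l}} (\<lambda>(t, x). p t * cos (\<kappa> * x) - w t x)"
        unfolding case_prod_unfold p_def using T0 T1 by (intro continuous_intros w_cont_on) auto
      show "p T1 * cos (\<kappa> * x) - w T1 x \<le> 0" if "x \<in> {0..l}" for x
      proof -
        have "m * cos (\<kappa> * x) \<le> m" using m by (intro mult_left_le) auto
        then have "m * cos (\<kappa> * x) \<le> w T1 x" using m0(2)[OF that] m by linarith
        then show ?thesis by (simp add: p_def)
      qed
      show "p \<tau> * cos (\<kappa> * l) - w \<tau> l \<le> 0" if "\<tau> \<in> {T1<..t}" for \<tau>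
        using w_nonneg[of \<tau> l] that T0 T1 l0 by (simp add: \<kappa>)
      show "p \<tau> * cos (\<kappa> * 0) - w \<tau> 0 \<le> 0 \<or>
          (\<exists>e\<ge>0. ((\<lambda>x. p \<tau> * cos (\<kappa> * x) - w \<tau> x) has_real_derivative e) (at 0 within {0..l}))"
        if "\<tau> \<in> {T1<..t}" for \<tau>
      proof -
        have "((\<lambda>x. p \<tau> * cos (\<kappa> * x) - w \<tau> x) has_real_derivative 0) (at 0 within {0..s \<tau>})"
          using that T0 T1 s_pos[of \<tau>] neumann[of \<tau>] by (auto intro!: derivative_eq_intros w_x)
        then have "((\<lambda>x. p \<tau> * cos (\<kappa> * x) - w \<tau> x) has_real_derivative 0) (at 0 within {0..l})"
          by (rule DERIV_subset) (use T1(2)[of \<tau>] that in auto)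
        then show ?thesis by blast
      qed
      fix \<tau> y assume \<tau>: "\<tau> \<in> {T1<..t}" and y: "y \<in> {0<..<l}"
      have in': "\<tau> > 0" "y \<in> {0<..<s \<tau>}" using \<tau> y T0 T1(1) T1(2)[of \<tau>] by auto
      show "((\<lambda>\<tau>. p \<tau> * cos (\<kappa> * y) - w \<tau> y) has_real_derivative m * (A' - p \<tau>) * cos (\<kappa> * y) - wt \<tau> y) (at \<tau>)"
        by (auto intro!: derivative_eq_intros p' w_t[OF in'])
      show "((\<lambda>x. p \<tau> * cos (\<kappa> * x) - w \<tau> x) has_real_derivative - (p \<tau> * \<kappa> * sin (\<kappa> * y)) - wx \<tau> y) (at y)"
        by (auto intro!: derivative_eq_intros w_x_interior[OF in'])
      show "((\<lambda>x. - (p \<tau> * \<kappa> * sin (\<kappa> * x)) - wx \<tau> x) has_real_derivative - (p \<tau> * \<kappa>\<^sup>2 * cos (\<kappa> * y)) - wxx \<tau> y) (at y)"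
        by (auto intro!: derivative_eq_intros w_xx[OF in'] simp: power2_eq_square)
      assume z: "p \<tau> * cos (\<kappa> * y) - w \<tau> y > 0"
      define c where "c = cos (\<kappa> * y)"
      define \<theta> where "\<theta> = p \<tau> * c"
      have c: "0 \<le> c" "c \<le> 1" using cos0[of y] y by (auto simp: c_def)
      have p\<tau>: "m \<le> p \<tau>" "p \<tau> \<le> A'" using p[of \<tau>] \<tau> by auto
      then have \<theta>: "0 \<le> \<theta>" "\<theta> \<le> p \<tau>" using c m by (auto simp: \<theta>_def intro!: mult_left_le)
      have w0: "w \<tau> y \<ge> 0" using in' by (intro w_nonneg) auto
      have "m * (A' - p \<tau>) * c \<le> p \<tau> * (A' - p \<tau>) * c" using p\<tau> c by (intro mult_right_mono) auto
      also have "\<dots> = \<theta> * (A - p \<tau>) - D * (p \<tau> * \<kappa>\<^sup>2 * c)" by (simp add: \<theta>_def A'_def algebra_simps)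
      also have "\<dots> \<le> \<theta> * (A - \<theta>) - D * (p \<tau> * \<kappa>\<^sup>2 * c)"
        using \<theta> by (intro diff_right_mono mult_left_mono) auto
      finally have 1: "m * (A' - p \<tau>) * c \<le> \<theta> * (A - \<theta>) - D * (p \<tau> * \<kappa>\<^sup>2 * c)" .
      have 2: "w \<tau> y * (A - w \<tau> y) \<le> w \<tau> y * q \<tau> y"
        using q[of \<tau> y] w0 \<tau> T1 y by (intro mult_left_mono) auto
      have "(\<theta> - w \<tau> y) * (A - \<theta> - w \<tau> y) \<le> (\<theta> - w \<tau> y) * A"
        using z \<theta> w0 by (intro mult_left_mono) (auto simp: \<theta>_def c_def)
      then have 3: "\<theta> * (A - \<theta>) - w \<tau> y * (A - w \<tau> y) \<le> A * (\<theta> - w \<tau> y)" by (simp add: algebra_simps)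
      show "m * (A' - p \<tau>) * cos (\<kappa> * y) - wt \<tau> y
          \<le> D * (- (p \<tau> * \<kappa>\<^sup>2 * cos (\<kappa> * y)) - wxx \<tau> y) + A * (p \<tau> * cos (\<kappa> * y) - w \<tau> y)"
        unfolding c_def[symmetric] \<theta>_def[symmetric] using 1 2 3 pde[OF in'] by (simp add: algebra_simps)
    qed (use t x l0 in auto)
    then show ?thesis by simp
  qed
  have "(p \<longlongrightarrow> A') at_top" unfolding p_def[abs_def]
    using tendsto_diff[OF tendsto_const tendsto_mult_right_zero[OF exp_decay_tendsto_0[OF m(1)]]] by simp
  then have "((\<lambda>t. p t * cos (\<kappa> * X)) \<longlongrightarrow> A' * cos (\<kappa> * X)) at_top" by (intro tendsto_intros)
  then have "\<forall>\<^sub>F t in at_top. p t * cos (\<kappa> * X) > A - \<epsilon>" using A' by (intro order_tendstoD) auto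
  then obtain T where T: "\<And>t. t \<ge> T \<Longrightarrow> p t * cos (\<kappa> * X) > A - \<epsilon>" by (auto simp: eventually_at_top_linorder)
  show ?thesis
  proof (intro exI[of _ "max T T1"] allI ballI impI)
    fix t x :: real assume t: "t \<ge> max T T1" and x: "x \<in> {0..X}"
    have "0 \<le> \<kappa> * x" "\<kappa> * x \<le> \<kappa> * X" using x \<kappa>(1) by (auto intro!: mult_left_mono)
    moreover have "\<kappa> * X \<le> pi" using range[of X] l \<open>X \<ge> 0\<close> pi_gt_zero by auto
    ultimately have "cos (\<kappa> * X) \<le> cos (\<kappa> * x)" by (rule cos_monotone_0_pi_le)
    then have "p t * cos (\<kappa> * X) \<le> p t * cos (\<kappa> * x)" using p[of t] m t by (intro mult_left_mono) auto
    then show "w t x \<ge> A - \<epsilon>" using below[of t x] T[of t] t x l by auto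
  qed
qed

lemma spreading_limit:
  assumes A: "A > 0" and s: "filterlim s at_top at_top"
    and q: "\<And>\<epsilon>. \<epsilon> > 0 \<Longrightarrow> \<exists>T\<ge>0. \<forall>t\<ge>T. \<forall>x\<ge>0. \<bar>q t x - (A - w t x)\<bar> \<le> \<epsilon>"
    and K: "compact K" "K \<subseteq> {0..}"
  shows "uniform_limit K w (\<lambda>x. A) at_top"
proof (rule uniform_limitI)
  fix \<epsilon> :: real assume "\<epsilon> > 0"
  obtain X where X: "X \<ge> 0" "\<And>x. x \<in> K \<Longrightarrow> \<bar>x\<bar> \<le> X"
    using compact_imp_bounded[OF K(1)] unfolding bounded_pos by (auto intro: less_imp_le)
  define \<eta> where "\<eta> = min (\<epsilon> / 4) (A / 2)"
  have \<eta>: "\<eta> > 0" "\<eta> < A" "\<eta> \<le> \<epsilon> / 4" using A \<open>\<epsilon> > 0\<close> by (auto simp: \<eta>_def min_def)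
  obtain T0 where T0: "T0 \<ge> 0" "\<And>t x. t \<ge> T0 \<Longrightarrow> x \<ge> 0 \<Longrightarrow> \<bar>q t x - (A - w t x)\<bar> \<le> \<eta>"
    using q[OF \<eta>(1)] by blast
  have bounds: "q t x \<le> A + \<eta> - w t x" "q t x \<ge> A - \<eta> - w t x" if "t \<ge> T0" "x \<ge> 0" for t x
    using T0(2)[OF that] by (auto simp: abs_le_iff)
  have pos: "A + \<eta> > 0" "A - \<eta> > 0" using A \<eta> by auto
  obtain T1 where T1: "\<And>t x. t \<ge> T1 \<Longrightarrow> x \<ge> 0 \<Longrightarrow> w t x \<le> A + \<eta> + \<eta>"
    using eventually_le[OF pos(1) T0(1) bounds(1) \<eta>(1)] by blast
  obtain T2 where T2: "\<And>t x. t \<ge> T2 \<Longrightarrow> x \<in> {0..X} \<Longrightarrow> w t x \<ge> A - \<eta> - \<eta>"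
    using eventually_ge[OF pos(2) T0(1) s bounds(2) \<eta>(1) X(1)] by blast
  show "\<forall>\<^sub>F t in at_top. \<forall>x\<in>K. dist (w t x) A < \<epsilon>"
    using eventually_ge_at_top[of "max T1 T2"]
  proof eventually_elim
    case (elim t)
    show ?case
    proof
      fix x assume "x \<in> K"
      then have x: "x \<ge> 0" "x \<in> {0..X}" using X K by force+
      have "w t x \<le> A + \<eta> + \<eta>" "w t x \<ge> A - \<eta> - \<eta>" using T1[of t x] T2[of t x] elim x by auto
      then show "dist (w t x) A < \<epsilon>" using \<eta> \<open>\<epsilon> > 0\<close> unfolding dist_real_def abs_less_iff by linarith
    qed
  qed
qed

end

lemma fb_component_imp_free_boundary:
  assumes fb: "fb_component D F k w0 s0 w s" and F: "F = (\<lambda>t x. w t x * q t x)"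
    and init: "admissible_init w0 s0"
    and "D > 0" "k > 0" and q: "continuous_on ({0..} \<times> {0..}) (\<lambda>(t, x). q t x)"
  shows "\<exists>wx wxx wt. free_boundary D k w q wx wxx wt s"
proof -
  obtain wx wxx wt where
    "continuous_on {(t,x). t > 0 \<and> 0 \<le> x \<and> x \<le> s t} (\<lambda>(t,x). wx t x)"
    "\<forall>t>0. \<forall>x\<in>{0..s t}. ((\<lambda>y. w t y) has_real_derivative wx t x) (at x within {0..s t})"
    "\<forall>t>0. \<forall>x\<in>{0<..<s t}. ((\<lambda>y. wx t y) has_real_derivative wxx t x) (at x)
        \<and> ((\<lambda>\<tau>. w \<tau> x) has_real_derivative wt t x) (at t) \<and> wt t x - D * wxx t x = F t x"
    "\<forall>t>0. wx t 0 = 0" "\<forall>t>0. (s has_real_derivative (- k * wx t (s t))) (at t)"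
    using fb unfolding fb_component_def by (elim conjE exE) (rule that)
  note der = this
  have "free_boundary D k w q wx wxx wt s"
  proof
    show "continuous_on {0..} s" "continuous_on ({0..} \<times> {0..}) (\<lambda>(t,x). w t x)"
      using fb by (auto simp: fb_component_def)
    show "s t > 0" if "t \<ge> 0" for t using fb that by (auto simp: fb_component_def)
    show "w t x = 0" if "t \<ge> 0" "x \<ge> s t" for t x using fb that by (auto simp: fb_component_def)
    show "w 0 x > 0" if "x \<in> {0..<s 0}" for x
      using fb init that by (auto simp: fb_component_def admissible_init_def)
    show "wt t x = D * wxx t x + w t x * q t x" if "t > 0" "x \<in> {0<..<s t}" for t x
      using der(3) that unfolding F by (auto simp: algebra_simps)
  qed (use der assms in auto)
  then show ?thesis by blast
qed

theorem theorem4p2: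
  fixes a b c d \<beta> \<mu> g0 h0 :: real
    and u0 v0 :: "real \<Rightarrow> real"
    and u v :: "real \<Rightarrow> real \<Rightarrow> real" and g h :: "real \<Rightarrow> real"
  assumes "a > 0" "b > 0" "c > 0" "d > 0" "\<beta> > 0" "\<mu> > 0"
    and "0 < h0" "h0 \<le> g0"
    and "admissible_init u0 g0" "admissible_init v0 h0"
    and "fb_solution a b c d \<beta> \<mu> g0 h0 u0 v0 u v g h"
  shows "((\<exists>G. (g \<longlongrightarrow> G) at_top) \<and> filterlim h at_top at_top \<longrightarrow>
            (\<forall>K. compact K \<and> K \<subseteq> {0..} \<longrightarrow> uniform_limit K (\<lambda>t x. v t x) (\<lambda>x. 1) at_top))
       \<and> ((\<exists>H. (h \<longlongrightarrow> H) at_top) \<and> filterlim g at_top at_top \<longrightarrow>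
            (\<forall>K. compact K \<and> K \<subseteq> {0..} \<longrightarrow> uniform_limit K (\<lambda>t x. u t x) (\<lambda>x. a) at_top))"
proof -
  define qu where "qu t x = a - u t x - b * v t x" for t x
  define qv where "qv t x = 1 - v t x + c * u t x" for t x
  have fbu: "fb_component d (\<lambda>t x. u t x * qu t x) \<beta> u0 g0 u g"
    and fbv: "fb_component 1 (\<lambda>t x. v t x * qv t x) \<mu> v0 h0 v h"
    using assms(11) by (auto simp: fb_solution_def qu_def qv_def)
  have cont: "continuous_on ({0..} \<times> {0..}) (\<lambda>p. u (fst p) (snd p))"
      "continuous_on ({0..} \<times> {0..}) (\<lambda>p. v (fst p) (snd p))"
    using fbu fbv by (auto simp: fb_component_def case_prod_unfold)
  have "continuous_on ({0..} \<times> {0..}) (\<lambda>(t, x). qu t x)"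
    unfolding qu_def case_prod_unfold by (intro continuous_intros cont)
  then obtain ux uxx ut where "free_boundary d \<beta> u qu ux uxx ut g"
    using fb_component_imp_free_boundary[OF fbu refl] assms by blast
  then interpret U: free_boundary d \<beta> u qu ux uxx ut g .
  have "continuous_on ({0..} \<times> {0..}) (\<lambda>(t, x). qv t x)"
    unfolding qv_def case_prod_unfold by (intro continuous_intros cont)
  then obtain vx vxx vt where "free_boundary 1 \<mu> v qv vx vxx vt h"
    using fb_component_imp_free_boundary[OF fbv refl] assms by force
  then interpret V: free_boundary 1 \<mu> v qv vx vxx vt h .
  obtain Mu where Mu: "\<And>t x. t \<ge> 0 \<Longrightarrow> x \<ge> 0 \<Longrightarrow> u t x \<le> Mu"
  proof -
    have "qu t x \<le> a - u t x" if "t \<ge> 0" "x \<ge> 0" for t x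
      using V.w_nonneg[OF that] \<open>b > 0\<close> by (simp add: qu_def)
    then show ?thesis using U.bounded_by_carrying_capacity[of a] that by blast
  qed
  obtain Mv where Mv: "\<And>t x. t \<ge> 0 \<Longrightarrow> x \<ge> 0 \<Longrightarrow> v t x \<le> Mv"
  proof -
    have "qv t x \<le> (1 + c * Mu) - v t x" if "t \<ge> 0" "x \<ge> 0" for t x
      using Mu[OF that] \<open>c > 0\<close> by (simp add: qv_def)
    then show ?thesis using V.bounded_by_carrying_capacity[of "1 + c * Mu"] that by blast
  qed
  have b_v: "0 \<le> b * v t x" "b * v t x \<le> b * Mv" and c_u: "0 \<le> c * u t x" "c * u t x \<le> c * Mu"
    if "t \<ge> 0" "x \<ge> 0" for t x
    using U.w_nonneg[OF that] V.w_nonneg[OF that] Mu[OF that] Mv[OF that] assms by auto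
  interpret U: bounded_free_boundary d \<beta> u qu ux uxx ut g Mu "a + Mu + b * Mv"
  proof
    fix t x :: real assume tx: "t \<ge> 0" "x \<ge> 0"
    show "u t x \<le> Mu" using Mu tx .
    show "\<bar>qu t x\<bar> \<le> a + Mu + b * Mv"
      using b_v[OF tx] Mu[OF tx] U.w_nonneg[OF tx] \<open>a > 0\<close> by (auto simp: qu_def abs_le_iff)
  qed
  interpret V: bounded_free_boundary 1 \<mu> v qv vx vxx vt h Mv "1 + Mv + c * Mu"
  proof
    fix t x :: real assume tx: "t \<ge> 0" "x \<ge> 0"
    show "v t x \<le> Mv" using Mv tx .
    show "\<bar>qv t x\<bar> \<le> 1 + Mv + c * Mu"
      using c_u[OF tx] Mv[OF tx] V.w_nonneg[OF tx] by (auto simp: qv_def abs_le_iff)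
  qed
  have "uniform_limit K v (\<lambda>x. 1) at_top"
    if g: "(g \<longlongrightarrow> G) at_top" and h: "filterlim h at_top at_top" and K: "compact K" "K \<subseteq> {0..}" for G K
  proof (rule V.spreading_limit[OF _ h _ K])
    fix \<epsilon> :: real assume "\<epsilon> > 0"
    then obtain T where T: "T \<ge> 0" "\<And>t x. t \<ge> T \<Longrightarrow> x \<ge> 0 \<Longrightarrow> u t x \<le> \<epsilon> / c"
      using U.vanishing[OF g, of "\<epsilon> / c"] \<open>c > 0\<close> by auto
    have "\<bar>qv t x - (1 - v t x)\<bar> \<le> \<epsilon>" if "t \<ge> T" "x \<ge> 0" for t x
      using T(2)[OF that] c_u[of t x] that T(1) \<open>c > 0\<close> by (simp add: qv_def field_simps)
    then show "\<exists>T\<ge>0. \<forall>t\<ge>T. \<forall>x\<ge>0. \<bar>qv t x - (1 - v t x)\<bar> \<le> \<epsilon>" using T(1) by blast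
  qed simp
  moreover have "uniform_limit K u (\<lambda>x. a) at_top"
    if h: "(h \<longlongrightarrow> H) at_top" and g: "filterlim g at_top at_top" and K: "compact K" "K \<subseteq> {0..}" for H K
  proof (rule U.spreading_limit[OF \<open>a > 0\<close> g _ K])
    fix \<epsilon> :: real assume "\<epsilon> > 0"
    then obtain T where T: "T \<ge> 0" "\<And>t x. t \<ge> T \<Longrightarrow> x \<ge> 0 \<Longrightarrow> v t x \<le> \<epsilon> / b"
      using V.vanishing[OF h, of "\<epsilon> / b"] \<open>b > 0\<close> by auto
    have "\<bar>qu t x - (a - u t x)\<bar> \<le> \<epsilon>" if "t \<ge> T" "x \<ge> 0" for t x
      using T(2)[OF that] b_v[of t x] that T(1) \<open>b > 0\<close> by (simp add: qu_def field_simps)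
    then show "\<exists>T\<ge>0. \<forall>t\<ge>T. \<forall>x\<ge>0. \<bar>qu t x - (a - u t x)\<bar> \<le> \<epsilon>" using T(1) by blast
  qed
  ultimately show ?thesis by blast
qed

end
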